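(* If $\varphi$ is a free holomorphic self-map of the ball $[B(\mathcal H)^n]_1$, then the composition operator $C_\varphi f:=f\circ\varphi$ is a bounded operator on $H^2_{\bf ball}$. Moreover, $$\frac{1}{(1-\|\varphi(0)\|^2)^{1/2}}\le\sup_{\lambda\in\mathbb B_n}\left(\frac{1-\|\lambda\|^2}{1-\|\varphi(\lambda)\|^2}\right)^{1/2}\le\|C_\varphi\|\le\left(\frac{1+\|\varphi(0)\|}{1-\|\varphi(0)\|}\right)^{1/2}.$$
   Context: $n\ge1$; $\mathcal H$ is a separable infinite dimensional complex Hilbert space. $\mathbb F_n^+$ is the free semigroup with generators $g_1,\ldots,g_n$ and identity $g_0$; $|g_0|=0$, $|\alpha|=k$ if $\alpha=g_{i_1}\cdots g_{i_k}$; $X_\alpha:=X_{i_1}\cdots X_{i_k}$, $X_{g_0}:=I$. $[B(\mathcal H)^n]_1:=\{(X_1,\ldots,X_n)\in B(\mathcal H)^n:\ \|X_1X_1^*+\cdots+X_nX_n^*\|^{1/2}<1\}$. A free holomorphic function $f:[B(\mathcal H)^n]_1\to B(\mathcal H)$ is a map $f(X)=\sum_{k=0}^\infty\sum_{|\alpha|=k}a_\alpha X_\alpha$ (series over $k$ converging in operator norm) with $a_\alpha\in\mathbb C$ and $\limsup_{k\to\infty}(\sum_{|\alpha|=k}|a_\alpha|^2)^{1/2k}\le1$. A free holomorphic self-map $\varphi=(\varphi_1,\ldots,\varphi_n)$ of $[B(\mathcal H)^n]_1$ has each $\varphi_i$ free holomorphic and $\varphi(X)\in[B(\mathcal H)^n]_1$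 for all $X\in[B(\mathcal H)^n]_1$. With $\varphi_\alpha:=\varphi_{i_1}\cdots\varphi_{i_k}$, the composition is the free holomorphic function $(f\circ\varphi)(X)=\sum_{k=0}^\infty\sum_{|\alpha|=k}a_\alpha\varphi_\alpha(X)$ (convergence in operator norm). $H^2_{\bf ball}$ is the Hilbert space of free holomorphic functions $f=\sum_\alpha a_\alpha X_\alpha$ on $[B(\mathcal H)^n]_1$ with $\|f\|_2^2:=\sum_{\alpha\in\mathbb F_n^+}|a_\alpha|^2<\infty$. $\mathbb B_n$ is the open Euclidean unit ball of $\mathbb C^n$; identifying $\lambda\in\mathbb B_n$ with $(\lambda_1I,\ldots,\lambda_nI)$, the map $\varphi$ induces a holomorphic self-map $\lambda\mapsto\varphi(\lambda)$ of $\mathbb B_n$, and norms of points of $\mathbb B_n$ are Euclidean. *)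

theory Defs
  imports "HOL-Analysis.Analysis"
begin

text \<open>
  Complex Hilbert spaces: the real Hilbert space structure of the library together with a
  compatible complex structure.  The inner product \<open>cinner\<close> is linear in its first argument;
  positive definiteness and \<open>norm x = sqrt (Re (cinner x x))\<close> follow from \<open>inner_cinner\<close>.
\<close>

class complex_hilbert = real_inner + complete_space +
  fixes scaleC :: "complex \<Rightarrow> 'a \<Rightarrow> 'a"  (infixr \<open>*\<^sub>C\<close> 75)
    and cinner :: "'a \<Rightarrow> 'a \<Rightarrow> complex"
  assumes scaleC_add_right: "c *\<^sub>C (x + y) = c *\<^sub>C x + c *\<^sub>C y"
    and scaleC_add_left: "(c + d) *\<^sub>C x = c *\<^sub>C x + d *\<^sub>C x"
    and scaleC_scaleC: "c *\<^sub>C d *\<^sub>C x = (c * d) *\<^sub>C x"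
    and scaleC_one: "1 *\<^sub>C x = x"
    and scaleR_scaleC: "r *\<^sub>R x = complex_of_real r *\<^sub>C x"
    and cinner_commute: "cinner x y = cnj (cinner y x)"
    and cinner_add_left: "cinner (x + y) z = cinner x z + cinner y z"
    and cinner_scaleC_left: "cinner (c *\<^sub>C x) y = c * cinner x y"
    and inner_cinner: "inner x y = Re (cinner x y)"

interpretation complex_vector: vector_space "scaleC :: complex \<Rightarrow> 'a \<Rightarrow> 'a::complex_hilbert"
  by unfold_locales
    (simp_all add: scaleC_add_right scaleC_add_left scaleC_scaleC scaleC_one)

lemma norm_eq_sqrt_cinner: "norm x = sqrt (Re (cinner x x))" for x :: "'a::complex_hilbert"
  by (simp add: norm_eq_sqrt_inner inner_cinner)

lemma norm_scaleC: "norm (c *\<^sub>C x) = cmod c * norm x" for x :: "'a::complex_hilbert"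
proof -
  have "cinner (c *\<^sub>C x) (c *\<^sub>C x) = c * cnj c * cinner x x"
    by (metis cinner_commute cinner_scaleC_left complex_cnj_mult mult.assoc)
  then have "Re (cinner (c *\<^sub>C x) (c *\<^sub>C x)) = (cmod c)\<^sup>2 * Re (cinner x x)"
    by (simp flip: complex_norm_square of_real_power)
  then show ?thesis
    by (simp add: norm_eq_sqrt_cinner real_sqrt_mult)
qed

definition infinite_dimensional :: "'h::complex_hilbert itself \<Rightarrow> bool" where
  "infinite_dimensional _ \<longleftrightarrow> \<not> (\<exists>B::'h set. finite B \<and> complex_vector.span B = UNIV)"

text \<open>
  \<open>B(H)\<close> is the set of complex linear elements of the library type of bounded real linear
  maps; its norm there is the operator norm.
\<close>

definition BH :: "('h::complex_hilbert \<Rightarrow>\<^sub>L 'h) set" where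
  "BH = {T. \<forall>c x. blinfun_apply T (c *\<^sub>C x) = c *\<^sub>C blinfun_apply T x}"

lift_definition op_scaleC ::
  "complex \<Rightarrow> ('h::complex_hilbert \<Rightarrow>\<^sub>L 'h) \<Rightarrow> ('h \<Rightarrow>\<^sub>L 'h)"  (infixr \<open>*\<^sub>O\<close> 75)
  is "\<lambda>c T x. c *\<^sub>C T x"
proof -
  fix c :: complex and T :: "'h \<Rightarrow> 'h"
  assume T: "bounded_linear T"
  have "bounded_linear (\<lambda>x::'h. c *\<^sub>C x)"
    by (rule bounded_linear_intro[where K = "cmod c"])
      (simp_all add: scaleC_add_right scaleR_scaleC scaleC_scaleC norm_scaleC mult.commute)
  then show "bounded_linear (\<lambda>x. c *\<^sub>C T x)"
    using T by (rule bounded_linear_compose)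
qed

definition cadjoint :: "('h::complex_hilbert \<Rightarrow>\<^sub>L 'h) \<Rightarrow> ('h \<Rightarrow>\<^sub>L 'h)" where
  "cadjoint T = (THE S. \<forall>x y. cinner (blinfun_apply T x) y = cinner x (blinfun_apply S y))"

text \<open>
  Operator tuples are indexed by a finite type \<open>'n\<close> (so \<open>n = CARD('n) \<ge> 1\<close>), and the free
  semigroup on \<open>n\<close> generators is \<open>'n list\<close>, with identity \<open>[]\<close> and length \<open>length\<close>.
\<close>

definition op_ball :: "('n::finite \<Rightarrow> ('h::complex_hilbert \<Rightarrow>\<^sub>L 'h)) set" where
  "op_ball = {X. (\<forall>i. X i \<in> BH) \<and> sqrt (norm (\<Sum>i\<in>UNIV. X i o\<^sub>L cadjoint (X i))) < 1}"

definition word_op ::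
  "('n \<Rightarrow> ('h::complex_hilbert \<Rightarrow>\<^sub>L 'h)) \<Rightarrow> 'n list \<Rightarrow> ('h \<Rightarrow>\<^sub>L 'h)" where
  "word_op X \<alpha> = foldr (\<lambda>i T. X i o\<^sub>L T) \<alpha> id_blinfun"

definition has_free_series ::
  "(('n::finite \<Rightarrow> ('h::complex_hilbert \<Rightarrow>\<^sub>L 'h)) \<Rightarrow> ('h \<Rightarrow>\<^sub>L 'h)) \<Rightarrow> ('n list \<Rightarrow> complex) \<Rightarrow> bool"
  where
  "has_free_series f a \<longleftrightarrow>
     limsup (\<lambda>k. ereal (root (2 * k) (\<Sum>\<alpha> | length \<alpha> = k. (cmod (a \<alpha>))\<^sup>2))) \<le> 1 \<and>
     (\<forall>X\<in>op_ball. (\<lambda>k. \<Sum>\<alpha> | length \<alpha> = k. a \<alpha> *\<^sub>O word_op X \<alpha>) sums f X)"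

definition free_holomorphic ::
  "(('n::finite \<Rightarrow> ('h::complex_hilbert \<Rightarrow>\<^sub>L 'h)) \<Rightarrow> ('h \<Rightarrow>\<^sub>L 'h)) \<Rightarrow> bool" where
  "free_holomorphic f \<longleftrightarrow> (\<exists>a. has_free_series f a)"

definition free_coeff ::
  "(('n::finite \<Rightarrow> ('h::complex_hilbert \<Rightarrow>\<^sub>L 'h)) \<Rightarrow> ('h \<Rightarrow>\<^sub>L 'h)) \<Rightarrow> 'n list \<Rightarrow> complex" where
  "free_coeff f = (THE a. has_free_series f a)"

definition free_self_map ::
  "(('n::finite \<Rightarrow> ('h::complex_hilbert \<Rightarrow>\<^sub>L 'h)) \<Rightarrow> ('n \<Rightarrow> ('h \<Rightarrow>\<^sub>L 'h))) \<Rightarrow> bool" where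
  "free_self_map \<phi> \<longleftrightarrow>
     (\<forall>i. free_holomorphic (\<lambda>X. \<phi> X i)) \<and> (\<forall>X\<in>op_ball. \<phi> X \<in> op_ball)"

text \<open>
  A function on the ball is represented in \<open>H2_ball\<close> by its extension by \<open>0\<close>, so that
  distinct elements of \<open>H2_ball\<close> are distinct functions on the ball.
\<close>

definition H2_ball ::
  "(('n::finite \<Rightarrow> ('h::complex_hilbert \<Rightarrow>\<^sub>L 'h)) \<Rightarrow> ('h \<Rightarrow>\<^sub>L 'h)) set" where
  "H2_ball = {f. free_holomorphic f \<and> (\<forall>X. X \<notin> op_ball \<longrightarrow> f X = 0) \<and>
                 (\<lambda>\<alpha>. (cmod (free_coeff f \<alpha>))\<^sup>2) summable_on UNIV}"

definition H2_norm ::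
  "(('n::finite \<Rightarrow> ('h::complex_hilbert \<Rightarrow>\<^sub>L 'h)) \<Rightarrow> ('h \<Rightarrow>\<^sub>L 'h)) \<Rightarrow> real" where
  "H2_norm f = sqrt (\<Sum>\<^sub>\<infinity>\<alpha>. (cmod (free_coeff f \<alpha>))\<^sup>2)"

definition bounded_H2_operator ::
  "((('n::finite \<Rightarrow> ('h::complex_hilbert \<Rightarrow>\<^sub>L 'h)) \<Rightarrow> ('h \<Rightarrow>\<^sub>L 'h)) \<Rightarrow>
    (('n \<Rightarrow> ('h \<Rightarrow>\<^sub>L 'h)) \<Rightarrow> ('h \<Rightarrow>\<^sub>L 'h))) \<Rightarrow> bool" where
  "bounded_H2_operator T \<longleftrightarrow>
     (\<forall>f\<in>H2_ball. T f \<in> H2_ball) \<and>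
     (\<forall>f\<in>H2_ball. \<forall>g\<in>H2_ball. T (\<lambda>X. f X + g X) = (\<lambda>X. T f X + T g X)) \<and>
     (\<forall>c. \<forall>f\<in>H2_ball. T (\<lambda>X. c *\<^sub>O f X) = (\<lambda>X. c *\<^sub>O T f X)) \<and>
     (\<exists>K. \<forall>f\<in>H2_ball. H2_norm (T f) \<le> K * H2_norm f)"

definition H2_opnorm ::
  "((('n::finite \<Rightarrow> ('h::complex_hilbert \<Rightarrow>\<^sub>L 'h)) \<Rightarrow> ('h \<Rightarrow>\<^sub>L 'h)) \<Rightarrow>
    (('n \<Rightarrow> ('h \<Rightarrow>\<^sub>L 'h)) \<Rightarrow> ('h \<Rightarrow>\<^sub>L 'h))) \<Rightarrow> real" where
  "H2_opnorm T = (SUP f\<in>{f \<in> H2_ball. H2_norm f \<le> 1}. H2_norm (T f))"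

definition comp_op ::
  "(('n::finite \<Rightarrow> ('h::complex_hilbert \<Rightarrow>\<^sub>L 'h)) \<Rightarrow> ('n \<Rightarrow> ('h \<Rightarrow>\<^sub>L 'h))) \<Rightarrow>
   (('n \<Rightarrow> ('h \<Rightarrow>\<^sub>L 'h)) \<Rightarrow> ('h \<Rightarrow>\<^sub>L 'h)) \<Rightarrow> (('n \<Rightarrow> ('h \<Rightarrow>\<^sub>L 'h)) \<Rightarrow> ('h \<Rightarrow>\<^sub>L 'h))" where
  "comp_op \<phi> f = (\<lambda>X. if X \<in> op_ball then f (\<phi> X) else 0)"

lemma comp_op_series:
  assumes "has_free_series f a" and "free_self_map \<phi>" and "X \<in> op_ball"
  shows "(\<lambda>k. \<Sum>\<alpha> | length \<alpha> = k. a \<alpha> *\<^sub>O word_op (\<phi> X) \<alpha>) sums comp_op \<phi> f X"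
  using assms by (simp add: has_free_series_def free_self_map_def comp_op_def)

text \<open>
  The self-map of the Euclidean ball induced by \<open>\<phi>\<close>: points \<open>\<lambda>\<close> of \<open>complex ^ 'n\<close> are
  identified with the tuples of scalar operators \<open>\<lambda>\<^sub>i I\<close>.
\<close>

definition scalar_tuple ::
  "complex ^ 'n \<Rightarrow> 'n::finite \<Rightarrow> ('h::complex_hilbert \<Rightarrow>\<^sub>L 'h)" where
  "scalar_tuple z = (\<lambda>i. (z $ i) *\<^sub>O id_blinfun)"

definition induced_map ::
  "(('n::finite \<Rightarrow> ('h::complex_hilbert \<Rightarrow>\<^sub>L 'h)) \<Rightarrow> ('n \<Rightarrow> ('h \<Rightarrow>\<^sub>L 'h))) \<Rightarrow>
   complex ^ 'n \<Rightarrow> complex ^ 'n" where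
  "induced_map \<phi> z = (THE w. \<phi> (scalar_tuple z) = scalar_tuple w)"

end

theory Submission
  imports Defs
begin

text \<open>
  Let \<open>S\<close> be the left creation operators on a copy of the full Fock space inside \<open>H\<close>, with vacuum
  \<open>\<Omega>\<close>. The coefficients of a free holomorphic \<open>g\<close> can be read off from \<open>g (r S) \<Omega>\<close>, so
  \<open>\<parallel>g\<parallel>\<^sub>2 = sup\<^sub>r \<parallel>g (r S) \<Omega>\<parallel>\<close>. The tuple \<open>\<Phi> = \<phi> (r S)\<close> is a row contraction and \<open>\<Omega>\<close> is a joint
  eigenvector of the adjoints \<open>\<Phi>\<^sub>i\<^sup>*\<close> with eigenvalues \<open>cnj (\<phi>\<^sub>i 0)\<close>. These two facts alone give, for
  polynomials \<open>p\<close> and \<open>\<rho> = \<parallel>\<phi> 0\<parallel>\<close>,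
  \<open>\<parallel>p (\<Phi>) \<Omega>\<parallel>\<^sup>2 + \<rho> \<bar>\<langle>p (\<Phi>) \<Omega>, \<Omega>\<rangle>\<bar>\<^sup>2 \<le> (1 + \<rho>) / (1 - \<rho>) \<parallel>p\<parallel>\<^sub>2\<^sup>2\<close>
  by induction on the degree, splitting \<open>p = a\<^sub>0 + \<Sum>\<^sub>i X\<^sub>i p\<^sub>i\<close>; this is the upper bound.
  The lower bound comes from testing \<open>C\<^sub>\<phi>\<close> on the normalized reproducing kernel at \<open>\<phi> (z)\<close> and
  evaluating at \<open>z\<close>.
\<close>

subsection \<open>Complex Hilbert spaces and row contractions\<close>

instance complex_hilbert \<subseteq> banach ..

lemma cinner_add_right: "cinner x (y + z) = cinner x y + cinner x z"
  for x :: "'h::complex_hilbert"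
  by (metis cinner_add_left cinner_commute complex_cnj_add)

lemma cinner_scaleC_right: "cinner x (c *\<^sub>C y) = cnj c * cinner x y"
  for x :: "'h::complex_hilbert"
  by (metis cinner_commute cinner_scaleC_left complex_cnj_mult)

lemma cinner_self: "cinner x x = complex_of_real ((norm x)\<^sup>2)"
  for x :: "'h::complex_hilbert"
proof (rule complex_eqI)
  show "Re (cinner x x) = Re (complex_of_real ((norm x)\<^sup>2))"
    using inner_cinner[of x x] by (simp add: power2_norm_eq_inner)
  have "Im (cinner x x) = - Im (cinner x x)"
    by (metis cinner_commute cnj.simps(2))
  then show "Im (cinner x x) = Im (complex_of_real ((norm x)\<^sup>2))" by simp
qed

text \<open>Multiplying \<open>x\<close> by a unimodular scalar makes the inner product real and
  nonnegative without changing \<open>norm x\<close>, so the real Cauchy-Schwarz inequality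
  applies.\<close>

lemma cmod_cinner_le: "cmod (cinner x y) \<le> norm x * norm y"
  for x :: "'h::complex_hilbert"
proof (cases "cinner x y = 0")
  case False
  define u where "u = cnj (sgn (cinner x y))"
  have "u * cinner x y = complex_of_real (cmod (cinner x y))"
    using False unfolding u_def sgn_eq
    by (simp add: complex_norm_square[symmetric] mult.commute field_simps power2_eq_square)
  then have "cmod (cinner x y) = inner (u *\<^sub>C x) y"
    by (simp add: inner_cinner cinner_scaleC_left)
  also have "\<dots> \<le> norm (u *\<^sub>C x) * norm y" by (rule norm_cauchy_schwarz)
  also have "norm (u *\<^sub>C x) = norm x" using False by (simp add: norm_scaleC u_def norm_sgn)
  finally show ?thesis .
qed simp

lemma bounded_linear_cinner_left: "bounded_linear (\<lambda>x. cinner x y)"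
  for y :: "'h::complex_hilbert"
  by (rule bounded_linear_intro[where K = "norm y"])
    (simp_all add: cinner_add_left scaleR_scaleC cinner_scaleC_left cmod_cinner_le scaleR_conv_of_real)

lemma bounded_linear_cinner_right: "bounded_linear (\<lambda>y. cinner x y)"
  for x :: "'h::complex_hilbert"
  by (rule bounded_linear_intro[where K = "norm x"])
    (simp_all add: cinner_add_right scaleR_scaleC cinner_scaleC_right scaleR_conv_of_real
      cmod_cinner_le[of x, unfolded mult.commute[of "norm x"]])

lemmas cinner_sum_left = bounded_linear.linear[OF bounded_linear_cinner_left, THEN linear_sum]
lemmas cinner_sum_right = bounded_linear.linear[OF bounded_linear_cinner_right, THEN linear_sum]
lemmas cinner_diff_left = bounded_linear.linear[OF bounded_linear_cinner_left, THEN linear_diff]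

lemma bounded_linear_scaleC_right: "bounded_linear (\<lambda>x::'h::complex_hilbert. c *\<^sub>C x)"
  by (rule bounded_linear_intro[where K = "cmod c"])
    (simp_all add: scaleC_add_right scaleR_scaleC scaleC_scaleC norm_scaleC mult.commute)

lemma cinner_eqI: "x = y" if "\<And>z. cinner z x = cinner z y"
  for x y :: "'h::complex_hilbert"
proof -
  have "inner (x - y) x = inner (x - y) y" using that by (simp add: inner_cinner)
  then show ?thesis by (simp add: inner_diff_right flip: right_minus_eq[of x y] inner_eq_zero_iff)
qed

lemma BH_scaleC: "T \<in> BH \<Longrightarrow> blinfun_apply T (c *\<^sub>C x) = c *\<^sub>C blinfun_apply T x"
  by (simp add: BH_def)

text \<open>The functional \<open>x \<mapsto> \<parallel>x\<parallel>\<^sup>2 - 2 f x\<close> attains its minimum at the representing vector, and a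
  minimizing sequence is Cauchy by the parallelogram law.\<close>

lemma Riesz_representation:
  fixes f :: "'a::{real_inner,complete_space} \<Rightarrow> real"
  assumes "bounded_linear f"
  obtains z where "\<And>x. f x = inner x z"
proof -
  interpret bounded_linear f by fact
  obtain K where K: "K \<ge> 0" "\<And>x. \<bar>f x\<bar> \<le> norm x * K" using nonneg_bounded by auto
  define g where "g x = (norm x)\<^sup>2 - 2 * f x" for x
  have lower: "g x \<ge> - K\<^sup>2" for x
  proof -
    have "(norm x - K)\<^sup>2 \<ge> 0" by simp
    then show ?thesis using K(2)[of x] by (auto simp: g_def power2_diff)
  qed
  define m where "m = Inf (range g)"
  have bdd: "bdd_below (range g)" using lower by (auto intro!: bdd_belowI)
  have m: "m \<le> g x" for x unfolding m_def by (rule cInf_lower) (auto simp: bdd)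
  have "\<exists>x. g x < m + inverse (real (Suc n))" for n
    using cInf_lessD[of "range g" "m + inverse (real (Suc n))"] by (auto simp: m_def)
  then obtain X where X: "\<And>n. g (X n) < m + inverse (real (Suc n))" by metis
  have par: "(norm (x - y))\<^sup>2 \<le> 2 * (g x - m) + 2 * (g y - m)" for x y
  proof -
    \<comment> \<open>In this combination the linear parts of \<open>g\<close> cancel, and the
      parallelogram law remains.\<close>
    have "(norm (x - y))\<^sup>2 = 2 * g x + 2 * g y - 4 * g ((1/2) *\<^sub>R (x + y))"
      unfolding g_def scaleR by (simp add: add power2_norm_eq_inner inner_simps inner_commute algebra_simps)
    moreover have "m \<le> g ((1/2) *\<^sub>R (x + y))" by (rule m)
    ultimately show ?thesis by argo
  qed
  have "Cauchy X"
  proof (rule metric_CauchyI)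
    fix \<epsilon> :: real assume "\<epsilon> > 0"
    then obtain N where N: "inverse (real (Suc N)) < \<epsilon>\<^sup>2 / 4"
      using reals_Archimedean[of "\<epsilon>\<^sup>2 / 4"] by auto
    show "\<exists>M. \<forall>i\<ge>M. \<forall>j\<ge>M. dist (X i) (X j) < \<epsilon>"
    proof (intro exI allI impI)
      fix i j assume ij: "N \<le> i" "N \<le> j"
      have "inverse (real (Suc i)) \<le> inverse (real (Suc N))" "inverse (real (Suc j)) \<le> inverse (real (Suc N))"
        using ij by (auto intro!: le_imp_inverse_le)
      with par[of "X i" "X j"] X[of i] X[of j] N have "(norm (X i - X j))\<^sup>2 < \<epsilon>\<^sup>2"
        by argo
      then show "dist (X i) (X j) < \<epsilon>"
        using \<open>\<epsilon> > 0\<close> by (simp add: dist_norm power2_less_imp_less)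
    qed
  qed
  then obtain z where z: "X \<longlonglongrightarrow> z" using Cauchy_convergent convergent_def by blast
  have "(\<lambda>n. g (X n)) \<longlonglongrightarrow> g z" unfolding g_def by (intro tendsto_intros tendsto z)
  moreover have "(\<lambda>n. m + inverse (real (Suc n))) \<longlonglongrightarrow> m + 0"
    by (intro tendsto_intros LIMSEQ_inverse_real_of_nat)
  ultimately have gz: "g z \<le> m + 0"
    by (rule LIMSEQ_le) (use X less_imp_le in blast)
  have "f x = inner x z" for x
  proof -
    \<comment> \<open>Minimality of \<open>z\<close> along the line \<open>z + t x\<close>: a
      quadratic in \<open>t\<close> that is nonnegative and vanishes at 0 has no linear
      term.\<close>
    have *: "0 \<le> t\<^sup>2 * (norm x)\<^sup>2 + 2 * t * (inner x z - f x)" for t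
    proof -
      have "g (z + t *\<^sub>R x) = g z + (t\<^sup>2 * (norm x)\<^sup>2 + 2 * t * (inner x z - f x))"
        unfolding g_def power2_norm_eq_inner
        by (simp add: add scaleR inner_simps inner_commute algebra_simps power2_eq_square)
      with m[of "z + t *\<^sub>R x"] gz show ?thesis by linarith
    qed
    define d where "d = inner x z - f x"
    \<comment> \<open>The summand 1 keeps \<open>q\<close> positive when \<open>x = 0\<close>. At
      \<open>t = - d/q\<close> the quadratic is at most \<open>- d\<^sup>2/q\<close>, which forces
      \<open>d = 0\<close>.\<close>
    define q where "q = (norm x)\<^sup>2 + 1"
    have q: "q > 0" "(norm x)\<^sup>2 \<le> q" by (auto simp: q_def add_nonneg_pos)
    have "0 \<le> (d/q)\<^sup>2 * (norm x)\<^sup>2 + 2 * (- d/q) * d"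
      using *[of "- d/q"] unfolding d_def[symmetric] by simp
    also have "\<dots> \<le> (d/q)\<^sup>2 * q + 2 * (- d/q) * d"
      using q by (intro add_right_mono mult_left_mono) auto
    also have "\<dots> = - (d\<^sup>2 / q)" using q by (simp add: field_simps power2_eq_square)
    finally have "d = 0" using q by (simp add: divide_le_0_iff)
    then show ?thesis by (simp add: d_def)
  qed
  then show ?thesis by (rule that)
qed

text \<open>Riesz representation yields the adjoint for the real inner product, and complex
  linearity of \<open>T\<close> makes it the complex adjoint. Existence and uniqueness together
  evaluate the \<open>THE\<close> in \<open>cadjoint\<close>.\<close>

lemma cadjoint:
  assumes T: "T \<in> BH"
  shows "cinner (blinfun_apply T x) y = cinner x (blinfun_apply (cadjoint T) y)"
proof -
  have "\<exists>z. \<forall>x. inner (T x) y = inner x z" for y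
  proof -
    have "bounded_linear (\<lambda>x. inner (T x) y)"
      by (intro bounded_linear_intros)
    then show ?thesis using Riesz_representation by metis
  qed
  then obtain S where S: "\<And>x y. inner (T x) y = inner x (S y)" by metis
  have cS: "cinner (T x) y = cinner x (S y)" for x y
  proof (rule complex_eqI)
    show "Re (cinner (T x) y) = Re (cinner x (S y))" using S by (simp add: inner_cinner)
    \<comment> \<open>Since \<open>Re (i c) = - Im c\<close>, testing with \<open>i x\<close>
      recovers the imaginary part.\<close>
    have "Re (cinner (T (\<i> *\<^sub>C x)) y) = Re (cinner (\<i> *\<^sub>C x) (S y))" using S by (simp add: inner_cinner)
    then show "Im (cinner (T x) y) = Im (cinner x (S y))"
      by (simp add: BH_scaleC[OF T] cinner_scaleC_left)
  qed
  have "bounded_linear S"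
  proof (rule bounded_linear_intro)
    fix y z show "S (y + z) = S y + S z"
      by (rule cinner_eqI) (simp add: cinner_add_right flip: cS)
  next
    fix r y show "S (r *\<^sub>R y) = r *\<^sub>R S y"
      by (rule cinner_eqI) (simp add: scaleR_scaleC cinner_scaleC_right flip: cS)
  next
    fix y
    have "(norm (S y))\<^sup>2 = inner (T (S y)) y" by (simp add: S power2_norm_eq_inner)
    also have "\<dots> \<le> norm (T (S y)) * norm y" by (rule norm_cauchy_schwarz)
    also have "\<dots> \<le> (norm T * norm (S y)) * norm y"
      by (intro mult_right_mono norm_blinfun norm_ge_zero)
    finally have "norm (S y) * norm (S y) \<le> norm (S y) * (norm y * norm T)"
      by (simp add: power2_eq_square mult_ac)
    then show "norm (S y) \<le> norm y * norm T"
      by (cases "S y = 0") (simp_all add: mult_le_cancel_left)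
  qed
  then have ex: "\<forall>x y. cinner (T x) y = cinner x (Blinfun S y)"
    by (simp add: cS bounded_linear_Blinfun_apply)
  have "\<forall>x y. cinner (T x) y = cinner x (cadjoint T y)"
    unfolding cadjoint_def
  proof (rule theI2[of _ "Blinfun S"])
    fix R assume "\<forall>x y. cinner (T x) y = cinner x (blinfun_apply R y)"
    with ex show "R = Blinfun S" by (intro blinfun_eqI cinner_eqI) metis
  qed (use ex in auto)
  then show ?thesis by simp
qed

text \<open>The row operator (X_1, ..., X_n) from the n-fold sum of H to H has norm at most
  \<open>\<bar>t\<bar>\<close>. This form avoids adjoints and suits inductions over words.\<close>

definition row_bound :: "('n::finite \<Rightarrow> ('h::complex_hilbert \<Rightarrow>\<^sub>L 'h)) \<Rightarrow> real \<Rightarrow> bool" where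
  "row_bound X t \<longleftrightarrow>
     (\<forall>h. (norm (\<Sum>i\<in>UNIV. blinfun_apply (X i) (h i)))\<^sup>2 \<le> t\<^sup>2 * (\<Sum>i\<in>UNIV. (norm (h i))\<^sup>2))"

lemma row_boundD:
  "row_bound X t \<Longrightarrow> (norm (\<Sum>i\<in>UNIV. blinfun_apply (X i) (h i)))\<^sup>2 \<le> t\<^sup>2 * (\<Sum>i\<in>UNIV. (norm (h i))\<^sup>2)"
  by (simp add: row_bound_def)

lemma sum_mult_le_sqrt:
  fixes f g :: "'i \<Rightarrow> real"
  shows "(\<Sum>i\<in>A. f i * g i) \<le> sqrt (\<Sum>i\<in>A. (f i)\<^sup>2) * sqrt (\<Sum>i\<in>A. (g i)\<^sup>2)"
proof -
  have "(\<Sum>i\<in>A. f i * g i) \<le> (\<Sum>i\<in>A. \<bar>f i\<bar> * \<bar>g i\<bar>)"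
    by (intro sum_mono) (simp flip: abs_mult)
  also have "\<dots> \<le> L2_set f A * L2_set g A" by (rule L2_set_mult_ineq)
  finally show ?thesis by (simp add: L2_set_def)
qed

text \<open>The norm of the sum of the X_i X_i^* is the square of the norm of the row operator. The
  strict inequality becomes a bound \<open>t < 1\<close>, the ratio of the geometric majorants used
  later.\<close>

lemma op_ball_iff:
  "X \<in> op_ball \<longleftrightarrow> (\<forall>i. X i \<in> BH) \<and> (\<exists>t. 0 \<le> t \<and> t < 1 \<and> row_bound X t)"
proof (cases "\<forall>i. X i \<in> BH")
  case True
  then have BH: "X i \<in> BH" for i by simp
  define T where "T = (\<Sum>i\<in>UNIV. X i o\<^sub>L cadjoint (X i))"
  have quad: "inner (T y) y = (\<Sum>i\<in>UNIV. (norm (cadjoint (X i) y))\<^sup>2)" for y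
    unfolding T_def
    by (simp add: blinfun.sum_left inner_cinner cinner_sum_left cadjoint[OF BH] cinner_self)
  \<comment> \<open>Pairing \<open>v\<close> with itself moves the \<open>X i\<close> to adjoints,
    whose squares sum to \<open>inner (T v) v\<close>; after Cauchy-Schwarz one factor
    \<open>norm v\<close> cancels.\<close>
  have bound: "row_bound X (sqrt (norm T))"
    unfolding row_bound_def
  proof
    fix h
    define v where "v = (\<Sum>i\<in>UNIV. X i (h i))"
    define s where "s = (\<Sum>i\<in>UNIV. (norm (h i))\<^sup>2)"
    have s: "s \<ge> 0" by (simp add: s_def sum_nonneg)
    have "(norm v)\<^sup>2 = (\<Sum>i\<in>UNIV. inner (h i) (cadjoint (X i) v))"
      unfolding power2_norm_eq_inner
      by (subst v_def) (simp add: inner_cinner cinner_sum_left cadjoint[OF BH])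
    also have "\<dots> \<le> (\<Sum>i\<in>UNIV. norm (h i) * norm (cadjoint (X i) v))"
      by (intro sum_mono norm_cauchy_schwarz)
    also have "\<dots> \<le> sqrt s * sqrt (inner (T v) v)"
      unfolding s_def quad by (rule sum_mult_le_sqrt)
    also have "\<dots> \<le> sqrt s * sqrt (norm T * (norm v)\<^sup>2)"
    proof (intro mult_left_mono real_sqrt_le_mono)
      have "inner (T v) v \<le> norm (T v) * norm v" by (rule norm_cauchy_schwarz)
      also have "\<dots> \<le> (norm T * norm v) * norm v" by (intro mult_right_mono norm_blinfun norm_ge_zero)
      finally show "inner (T v) v \<le> norm T * (norm v)\<^sup>2" by (simp add: power2_eq_square mult_ac)
    qed (use s in auto)
    finally have "(norm v)\<^sup>2 \<le> sqrt s * (sqrt (norm T) * norm v)"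
      by (simp add: real_sqrt_mult)
    then have "norm v * norm v \<le> norm v * (sqrt s * sqrt (norm T))"
      by (simp add: power2_eq_square mult_ac)
    then have "norm v \<le> sqrt s * sqrt (norm T)"
      by (cases "v = 0") (simp_all add: mult_le_cancel_left s)
    then have "(norm v)\<^sup>2 \<le> (sqrt s * sqrt (norm T))\<^sup>2" by (intro power_mono) auto
    then show "(norm (\<Sum>i\<in>UNIV. X i (h i)))\<^sup>2 \<le> (sqrt (norm T))\<^sup>2 * (\<Sum>i\<in>UNIV. (norm (h i))\<^sup>2)"
      using s by (simp add: v_def s_def power_mult_distrib mult.commute)
  qed
  \<comment> \<open>Conversely, the row bound is applied to the tuple of the
    \<open>cadjoint (X i) y\<close>, and one factor \<open>norm (T y)\<close> cancels.\<close>
  have conv: "norm T \<le> t\<^sup>2" if t: "row_bound X t" "t \<ge> 0" for t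
  proof (rule norm_blinfun_bound)
    fix y
    have "(norm (T y))\<^sup>2 \<le> t\<^sup>2 * (\<Sum>i\<in>UNIV. (norm (cadjoint (X i) y))\<^sup>2)"
      using row_boundD[OF t(1), of "\<lambda>i. cadjoint (X i) y"] by (simp add: T_def blinfun.sum_left)
    also have "\<dots> \<le> t\<^sup>2 * (norm (T y) * norm y)"
      unfolding quad[symmetric] by (intro mult_left_mono norm_cauchy_schwarz) auto
    finally have "norm (T y) * norm (T y) \<le> norm (T y) * (t\<^sup>2 * norm y)"
      by (simp add: power2_eq_square mult_ac)
    then show "norm (T y) \<le> t\<^sup>2 * norm y"
      by (cases "T y = 0") (simp_all add: mult_le_cancel_left)
  qed simp
  have "sqrt (norm T) < 1 \<longleftrightarrow> (\<exists>t. 0 \<le> t \<and> t < 1 \<and> row_bound X t)"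
  proof
    assume "\<exists>t. 0 \<le> t \<and> t < 1 \<and> row_bound X t"
    then obtain t where t: "0 \<le> t" "t < 1" "row_bound X t" by blast
    have "sqrt (norm T) \<le> t" using conv[OF t(3,1)] t(1) by (simp add: real_le_lsqrt)
    with t show "sqrt (norm T) < 1" by linarith
  qed (use bound in \<open>auto intro!: exI[of _ "sqrt (norm T)"]\<close>)
  with BH show ?thesis by (simp add: op_ball_def T_def)
qed (auto simp: op_ball_def)

subsection \<open>The left creation operators\<close>

definition orthonormal :: "('b \<Rightarrow> 'h::complex_hilbert) \<Rightarrow> bool" where
  "orthonormal e \<longleftrightarrow> (\<forall>a b. cinner (e a) (e b) = of_bool (a = b))"

lemma cinner_orthonormal_sum:
  assumes "orthonormal e" "finite F"
  shows "cinner (\<Sum>a\<in>F. c a *\<^sub>C e a) (e b) = (if b \<in> F then c b else 0)"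
proof -
  have "cinner (\<Sum>a\<in>F. c a *\<^sub>C e a) (e b) = (\<Sum>a\<in>F. if a = b then c a else 0)"
    unfolding cinner_sum_left
    using assms by (intro sum.cong refl) (auto simp: orthonormal_def cinner_scaleC_left)
  with assms show ?thesis by simp
qed

lemma norm_orthonormal_sum:
  assumes "orthonormal e" "finite F"
  shows "(norm (\<Sum>a\<in>F. c a *\<^sub>C e a))\<^sup>2 = (\<Sum>a\<in>F. (cmod (c a))\<^sup>2)"
proof -
  have "complex_of_real ((norm (\<Sum>a\<in>F. c a *\<^sub>C e a))\<^sup>2) = (\<Sum>b\<in>F. cnj (c b) * c b)"
    unfolding cinner_self[symmetric] cinner_sum_right[of _ _ F] cinner_scaleC_right
    using assms by (simp add: cinner_orthonormal_sum)
  also have "\<dots> = complex_of_real (\<Sum>a\<in>F. (cmod (c a))\<^sup>2)"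
    by (simp only: of_real_sum complex_norm_square mult.commute)
  finally show ?thesis by (simp only: of_real_eq_iff)
qed

text \<open>\<open>s\<close> is the orthogonal projection of \<open>h\<close> onto the span of the
  \<open>e a\<close>, so \<open>norm (h - s)\<close> satisfies Pythagoras.\<close>

lemma Bessel:
  assumes e: "orthonormal e" and F: "finite F"
  shows "(\<Sum>a\<in>F. (cmod (cinner h (e a)))\<^sup>2) \<le> (norm h)\<^sup>2"
proof -
  define s where "s = (\<Sum>a\<in>F. cinner h (e a) *\<^sub>C e a)"
  have s: "(norm s)\<^sup>2 = (\<Sum>a\<in>F. (cmod (cinner h (e a)))\<^sup>2)"
    unfolding s_def by (rule norm_orthonormal_sum[OF e F])
  have "cinner h s = complex_of_real ((norm s)\<^sup>2)"
    unfolding s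
    by (simp add: s_def cinner_sum_right cinner_scaleC_right complex_norm_square mult.commute
        del: of_real_power)
  then have "inner h s = (norm s)\<^sup>2" by (simp add: inner_cinner)
  then have "(norm (h - s))\<^sup>2 = (norm h)\<^sup>2 - (norm s)\<^sup>2"
    by (simp add: power2_norm_eq_inner inner_diff_left inner_diff_right inner_commute)
  moreover have "(norm (h - s))\<^sup>2 \<ge> 0" by simp
  ultimately show ?thesis using s by linarith
qed

text \<open>By Pythagoras the distance between nested partial sums is a difference of values of
  \<open>w\<close>, so boundedness of \<open>w\<close> makes the net of partial sums Cauchy.\<close>

lemma summable_on_orthonormal:
  fixes e :: "'b \<Rightarrow> 'h::complex_hilbert"
  assumes e: "orthonormal e" and bd: "\<And>F. finite F \<Longrightarrow> (\<Sum>a\<in>F. (cmod (c a))\<^sup>2) \<le> K"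
  shows "(\<lambda>a. c a *\<^sub>C e a) summable_on UNIV"
proof -
  define f where "f a = c a *\<^sub>C e a" for a
  define w where "w F = (\<Sum>a\<in>F. (cmod (c a))\<^sup>2)" for F
  define m where "m = (SUP F\<in>Collect finite. w F)"
  have bdd: "bdd_above (w ` Collect finite)" using bd by (auto simp: w_def intro!: bdd_aboveI)
  have "\<exists>P. eventually P (finite_subsets_at_top UNIV) \<and>
          (\<forall>F F'. P F \<and> P F' \<longrightarrow> dist (sum f F) (sum f F') < \<epsilon>)" if "\<epsilon> > 0" for \<epsilon>
  proof -
    \<comment> \<open>A finite set that nearly attains the supremum \<open>m\<close>: any
      enlargement adds less than \<open>(\<epsilon>/2)\<^sup>2\<close> to \<open>w\<close>.\<close>
    have "\<exists>F\<in>Collect finite. m - (\<epsilon>/2)\<^sup>2 < w F"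
      unfolding m_def using that by (subst less_cSUP_iff[OF _ bdd, symmetric]) (auto simp: m_def)
    then obtain F0 where F0: "finite F0" "m - (\<epsilon>/2)\<^sup>2 < w F0" by auto
    have near: "dist (sum f F) (sum f F0) < \<epsilon>/2" if F: "finite F" "F0 \<subseteq> F" for F
    proof -
      have "(norm (sum f F - sum f F0))\<^sup>2 = (norm (sum f (F - F0)))\<^sup>2"
        using F F0 by (simp add: sum_diff)
      also have "\<dots> = w (F - F0)"
        unfolding f_def w_def by (rule norm_orthonormal_sum) (use e F in auto)
      also have "\<dots> = w F - w F0" unfolding w_def using F F0 by (simp add: sum_diff)
      also have "\<dots> < (\<epsilon>/2)\<^sup>2"
      proof -
        have "w F \<le> m" unfolding m_def by (rule cSUP_upper[OF _ bdd]) (use F in auto)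
        with F0 show ?thesis by argo
      qed
      finally show ?thesis using \<open>\<epsilon> > 0\<close> unfolding dist_norm
        by (meson half_gt_zero less_imp_le power2_less_imp_less)
    qed
    show ?thesis
    proof (intro exI conjI allI impI)
      show "eventually (\<lambda>F. finite F \<and> F0 \<subseteq> F) (finite_subsets_at_top UNIV)"
        using F0 by (auto simp: eventually_finite_subsets_at_top)
    next
      fix F F' assume "(finite F \<and> F0 \<subseteq> F) \<and> (finite F' \<and> F0 \<subseteq> F')"
      then show "dist (sum f F) (sum f F') < \<epsilon>"
        using near[of F] near[of F'] by (simp add: dist_triangle_half_l)
    qed
  qed
  then have "cauchy_filter (filtermap (sum f) (finite_subsets_at_top UNIV))"
    by (simp add: cauchy_filter_metric_filtermap)
  moreover have "complete (UNIV::'h set)"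
    by (meson Cauchy_convergent UNIV_I complete_def convergent_def)
  ultimately obtain L where "(sum f \<longlongrightarrow> L) (finite_subsets_at_top UNIV)"
    using complete_uniform[where S=UNIV] by (force simp add: filterlim_def)
  then show ?thesis
    using summable_on_def has_sum_def unfolding f_def by blast
qed

text \<open>Gram-Schmidt by well-founded choice: finitely many vectors never span, so a further unit
  vector orthogonal to them exists.\<close>

lemma exists_orthonormal_sequence:
  assumes inf: "infinite_dimensional TYPE('h::complex_hilbert)"
  obtains e :: "nat \<Rightarrow> 'h::complex_hilbert" where "orthonormal e"
proof -
  define P where "P f n u \<longleftrightarrow> norm u = 1 \<and> (\<forall>m<n. cinner u (f m) = 0)" for f and n :: nat and u :: 'h
  have "\<exists>e. \<forall>n. P e n (e n)"
  proof (rule dependent_wellorder_choice[where P = P])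
    fix r :: 'h and f g :: "nat \<Rightarrow> 'h" and x :: nat
    assume "\<And>y. y < x \<Longrightarrow> f y = g y"
    then show "P f x r = P g x r" by (auto simp: P_def)
  next
    fix x :: nat and f :: "nat \<Rightarrow> 'h"
    assume IH: "\<And>y. y < x \<Longrightarrow> P f y (f y)"
    have orth: "cinner (f a) (f b) = of_bool (a = b)" if "a < x" "b < x" for a b
    proof (cases a b rule: linorder_cases)
      case less
      then have "cinner (f b) (f a) = 0" using IH[OF that(2)] by (auto simp: P_def)
      then show ?thesis using less by (subst cinner_commute) auto
    next
      case greater
      then show ?thesis using IH[OF that(1)] by (auto simp: P_def)
    next
      case equal
      then show ?thesis using IH[OF that(1)] by (auto simp: P_def cinner_self)
    qed
    have "complex_vector.span (f ` {..<x}) \<noteq> UNIV"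
      using inf unfolding infinite_dimensional_def by blast
    then obtain v where v: "v \<notin> complex_vector.span (f ` {..<x})" by blast
    define s where "s = (\<Sum>a<x. cinner v (f a) *\<^sub>C f a)"
    have "s \<in> complex_vector.span (f ` {..<x})" unfolding s_def
      by (intro complex_vector.span_sum complex_vector.span_scale complex_vector.span_base) auto
    with v have ne: "v - s \<noteq> 0" by auto
    have "cinner (v - s) (f b) = 0" if "b < x" for b
    proof -
      have "cinner s (f b) = (\<Sum>a<x. cinner v (f a) * of_bool (a = b))"
        unfolding s_def cinner_sum_left cinner_scaleC_left by (intro sum.cong refl) (simp add: orth that)
      also have "\<dots> = cinner v (f b)" using that by (simp add: of_bool_def if_distrib cong: if_cong)
      finally show ?thesis by (simp add: cinner_diff_left)
    qed
    then have "P f x (inverse (norm (v - s)) *\<^sub>R (v - s))"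
      using ne by (simp add: P_def scaleR_scaleC cinner_scaleC_left norm_scaleC norm_inverse)
    then show "\<exists>r. P f x r" by blast
  qed
  then obtain e where "\<And>n. P e n (e n)" by blast
  then have e: "\<And>n. norm (e n) = 1" "\<And>n m. m < n \<Longrightarrow> cinner (e n) (e m) = 0"
    by (auto simp: P_def)
  have "orthonormal e"
    unfolding orthonormal_def
  proof (intro allI)
    fix a b
    show "cinner (e a) (e b) = of_bool (a = b)"
    proof (cases a b rule: linorder_cases)
      case less
      then show ?thesis using e(2)[OF less] by (subst cinner_commute) auto
    qed (use e in \<open>auto simp: cinner_self\<close>)
  qed
  then show ?thesis by (rule that)
qed

text \<open>Exactly what is needed of the left creation operators, with vacuum \<open>e []\<close>.
  The \<open>e \<alpha>\<close> need not span H. The assumption \<open>vacuum\<close> says that the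
  adjoints annihilate the vacuum.\<close>

locale free_shift =
  fixes S :: "'n::finite \<Rightarrow> ('h::complex_hilbert \<Rightarrow>\<^sub>L 'h)" and e :: "'n list \<Rightarrow> 'h"
  assumes orth: "orthonormal e"
    and BH: "S i \<in> BH"
    and shift: "blinfun_apply (S i) (e \<alpha>) = e (i # \<alpha>)"
    and vacuum: "cinner (blinfun_apply (S i) h) (e []) = 0"
    and row: "row_bound S 1"

text \<open>Words are countable, so an orthonormal sequence can be indexed by them.
  \<open>T i\<close> sends \<open>e \<alpha>\<close> to \<open>e (i # \<alpha>)\<close> and kills
  the orthogonal complement of all the \<open>e \<alpha>\<close>.\<close>

lemma exists_free_shift:
  assumes inf: "infinite_dimensional TYPE('h::complex_hilbert)"
  shows "\<exists>(S :: 'n::finite \<Rightarrow> ('h::complex_hilbert \<Rightarrow>\<^sub>L 'h)) e. free_shift S e"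
proof -
  obtain e0 :: "nat \<Rightarrow> 'h" where "orthonormal e0" using exists_orthonormal_sequence[OF inf] .
  define e :: "'n list \<Rightarrow> 'h" where "e = e0 \<circ> to_nat"
  have e: "orthonormal e" using \<open>orthonormal e0\<close> by (simp add: orthonormal_def e_def)
  have ei: "orthonormal (\<lambda>\<alpha>. e (i # \<alpha>))" for i using e by (simp add: orthonormal_def)
  define T where "T i h = (\<Sum>\<^sub>\<infinity>\<alpha>. cinner h (e \<alpha>) *\<^sub>C e (i # \<alpha>))" for i and h :: 'h
  have "(\<lambda>\<alpha>. cinner h (e \<alpha>) *\<^sub>C e (i # \<alpha>)) summable_on UNIV" for i h
    by (rule summable_on_orthonormal[OF ei, where K="(norm h)\<^sup>2"]) (rule Bessel[OF e])
  then have T: "((\<lambda>\<alpha>. cinner h (e \<alpha>) *\<^sub>C e (i # \<alpha>)) has_sum T i h) UNIV" for i h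
    unfolding T_def by (rule has_sum_infsum)
  \<comment> \<open>The \<open>e (i # \<alpha>)\<close>, over all pairs of a letter and a word, form
    one orthonormal family. Finite truncations therefore obey the bound by Bessel, and it survives
    the limit.\<close>
  have row: "(norm (\<Sum>i\<in>UNIV. T i (h i)))\<^sup>2 \<le> (\<Sum>i\<in>UNIV. (norm (h i))\<^sup>2)" for h
  proof (rule tendsto_upperbound)
    show "((\<lambda>F. (norm (\<Sum>i\<in>UNIV. \<Sum>\<alpha>\<in>F. cinner (h i) (e \<alpha>) *\<^sub>C e (i # \<alpha>)))\<^sup>2)
            \<longlongrightarrow> (norm (\<Sum>i\<in>UNIV. T i (h i)))\<^sup>2) (finite_subsets_at_top UNIV)"
      by (intro tendsto_intros T[unfolded has_sum_def])
    have "(norm (\<Sum>i\<in>UNIV. \<Sum>\<alpha>\<in>F. cinner (h i) (e \<alpha>) *\<^sub>C e (i # \<alpha>)))\<^sup>2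
        \<le> (\<Sum>i\<in>UNIV. (norm (h i))\<^sup>2)" if "finite F" for F
    proof -
      have o: "orthonormal (\<lambda>p. e (fst p # snd p))"
        using e by (auto simp: orthonormal_def prod_eq_iff)
      have "(norm (\<Sum>i\<in>UNIV. \<Sum>\<alpha>\<in>F. cinner (h i) (e \<alpha>) *\<^sub>C e (i # \<alpha>)))\<^sup>2
          = (norm (\<Sum>p\<in>UNIV \<times> F. cinner (h (fst p)) (e (snd p)) *\<^sub>C e (fst p # snd p)))\<^sup>2"
        by (simp add: sum.cartesian_product case_prod_unfold)
      also have "\<dots> = (\<Sum>p\<in>UNIV \<times> F. (cmod (cinner (h (fst p)) (e (snd p))))\<^sup>2)"
        by (rule norm_orthonormal_sum[OF o]) (use that in auto)
      also have "\<dots> = (\<Sum>i\<in>UNIV. \<Sum>\<alpha>\<in>F. (cmod (cinner (h i) (e \<alpha>)))\<^sup>2)"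
        by (simp add: sum.cartesian_product case_prod_unfold)
      also have "\<dots> \<le> (\<Sum>i\<in>UNIV. (norm (h i))\<^sup>2)" by (intro sum_mono Bessel e that)
      finally show ?thesis .
    qed
    then show "\<forall>\<^sub>F F in finite_subsets_at_top UNIV.
        (norm (\<Sum>i\<in>UNIV. \<Sum>\<alpha>\<in>F. cinner (h i) (e \<alpha>) *\<^sub>C e (i # \<alpha>)))\<^sup>2 \<le> (\<Sum>i\<in>UNIV. (norm (h i))\<^sup>2)"
      by (rule eventually_finite_subsets_at_top_weakI)
  qed simp
  have scale: "T i (c *\<^sub>C h) = c *\<^sub>C T i h" for i c h
  proof (rule has_sum_unique[OF T])
    from has_sum_bounded_linear[OF bounded_linear_scaleC_right T]
    show "((\<lambda>\<alpha>. cinner (c *\<^sub>C h) (e \<alpha>) *\<^sub>C e (i # \<alpha>)) has_sum c *\<^sub>C T i h) UNIV"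
      by (simp add: o_def cinner_scaleC_left scaleC_scaleC)
  qed
  have lin: "bounded_linear (T i)" for i
  proof (rule bounded_linear_intro[where K=1])
    show "T i (x + y) = T i x + T i y" for x y
      using has_sum_add[OF T[of x i] T[of y i]]
      by (intro has_sum_unique[OF T]) (simp add: cinner_add_left scaleC_add_left)
    show "T i (r *\<^sub>R x) = r *\<^sub>R T i x" for r x by (simp add: scaleR_scaleC scale)
    have T0: "T i 0 = 0" for i using scale[of i 0 0] by (simp add: complex_vector.scale_zero_left)
    \<comment> \<open>The row estimate for the tuple with \<open>x\<close> in position
      \<open>i\<close> and 0 elsewhere.\<close>
    show "norm (T i x) \<le> norm x * 1" for x
    proof -
      have "(\<Sum>j\<in>UNIV. T j (if j = i then x else 0)) = (\<Sum>j\<in>UNIV. if j = i then T i x else 0)"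
        by (intro sum.cong refl) (simp add: T0)
      moreover have "(\<Sum>j\<in>UNIV. (norm (if j = i then x else 0))\<^sup>2) = (\<Sum>j\<in>UNIV. if j = i then (norm x)\<^sup>2 else 0)"
        by (intro sum.cong refl) simp
      ultimately have "(norm (T i x))\<^sup>2 \<le> (norm x)\<^sup>2"
        using row[of "\<lambda>j. if j = i then x else 0"] by simp
      then show ?thesis using power2_le_imp_le[OF _ norm_ge_zero] by simp
    qed
  qed
  define S where "S i = Blinfun (T i)" for i
  have S: "blinfun_apply (S i) = T i" for i by (simp add: S_def bounded_linear_Blinfun_apply lin)
  have "free_shift S e"
  proof
    show "S i \<in> BH" for i by (simp add: BH_def S scale)
    show "row_bound S 1" using row by (simp add: row_bound_def S)
    show "S i (e \<alpha>) = e (i # \<alpha>)" for i \<alpha>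
    proof -
      have "((\<lambda>\<beta>. cinner (e \<alpha>) (e \<beta>) *\<^sub>C e (i # \<beta>)) has_sum e (i # \<alpha>)) UNIV"
        by (rule has_sum_finite_neutralI[where B="{\<alpha>}"])
          (use e in \<open>auto simp: orthonormal_def scaleC_one complex_vector.scale_zero_left\<close>)
      then show ?thesis unfolding S using T has_sum_unique by blast
    qed
    show "cinner (S i h) (e []) = 0" for i h
    proof -
      have "((\<lambda>\<alpha>. cinner (cinner h (e \<alpha>) *\<^sub>C e (i # \<alpha>)) (e [])) has_sum cinner (S i h) (e [])) UNIV"
        using has_sum_bounded_linear[OF bounded_linear_cinner_left T] by (simp add: S o_def)
      moreover have "cinner (cinner h (e \<alpha>) *\<^sub>C e (i # \<alpha>)) (e []) = 0" for \<alpha>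
        using e by (simp add: orthonormal_def cinner_scaleC_left)
      ultimately show ?thesis using has_sum_unique[OF _ has_sum_0] by fastforce
    qed
  qed (fact e)
  then show ?thesis by blast
qed

subsection \<open>Homogeneous expansions\<close>

definition hom_part :: "('n::finite list \<Rightarrow> complex) \<Rightarrow> nat \<Rightarrow> ('n \<Rightarrow> ('h::complex_hilbert \<Rightarrow>\<^sub>L 'h)) \<Rightarrow> ('h \<Rightarrow>\<^sub>L 'h)" where
  "hom_part a k X = (\<Sum>\<alpha> | length \<alpha> = k. a \<alpha> *\<^sub>O word_op X \<alpha>)"

text \<open>The quantity under the root in \<open>has_free_series\<close>. Its square root is the
  norm of the degree \<open>k\<close> part at the creation operators, applied to the vacuum
  (\<open>norm_hom_vacuum\<close>).\<close>

definition wt :: "('n::finite list \<Rightarrow> complex) \<Rightarrow> nat \<Rightarrow> real" where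
  "wt a k = (\<Sum>\<alpha> | length \<alpha> = k. (cmod (a \<alpha>))\<^sup>2)"

lemma finite_words [simp]: "finite {\<alpha> :: 'n::finite list. length \<alpha> = k}"
  using finite_lists_length_eq[of "UNIV :: 'n set" k] by simp

lemma sum_words_Suc:
  "(\<Sum>\<alpha> :: 'n::finite list | length \<alpha> = Suc k. f \<alpha>) = (\<Sum>i\<in>UNIV. \<Sum>\<alpha> | length \<alpha> = k. f (i # \<alpha>))"
proof -
  have "{\<alpha> :: 'n list. length \<alpha> = Suc k} = (\<lambda>(i, \<alpha>). i # \<alpha>) ` (UNIV \<times> {\<alpha>. length \<alpha> = k})"
    by (force simp: image_iff length_Suc_conv)
  moreover have "inj_on (\<lambda>(i, \<alpha>). i # \<alpha>) (UNIV \<times> {\<alpha> :: 'n list. length \<alpha> = k})"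
    by (auto simp: inj_on_def)
  ultimately show ?thesis
    by (simp add: sum.reindex sum.cartesian_product case_prod_unfold)
qed

lemma wt_0: "wt a 0 = (cmod (a []))\<^sup>2" by (simp add: wt_def)

lemma wt_Suc: "wt a (Suc k) = (\<Sum>i\<in>UNIV. wt (\<lambda>\<alpha>. a (i # \<alpha>)) k)"
  by (simp add: wt_def sum_words_Suc)

lemma wt_nonneg [simp]: "wt a k \<ge> 0" by (simp add: wt_def sum_nonneg)

lemma word_op_Nil [simp]: "word_op X [] = id_blinfun" by (simp add: word_op_def)
lemma word_op_Cons [simp]: "word_op X (i # \<alpha>) = X i o\<^sub>L word_op X \<alpha>" by (simp add: word_op_def)

lemma op_scaleC_apply [simp]: "blinfun_apply (c *\<^sub>O T) x = c *\<^sub>C blinfun_apply T x"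
  by (simp add: op_scaleC.rep_eq)

lemma hom_0: "hom_part a 0 X = a [] *\<^sub>O id_blinfun" by (simp add: hom_part_def)

text \<open>Grouping words by their first letter. This recursion drives the inductions on the
  degree; membership in \<open>BH\<close> lets the coefficients pass through
  \<open>X i\<close>.\<close>

lemma hom_Suc:
  assumes "\<And>i. X i \<in> BH"
  shows "hom_part a (Suc k) X = (\<Sum>i\<in>UNIV. X i o\<^sub>L hom_part (\<lambda>\<alpha>. a (i # \<alpha>)) k X)"
  by (rule blinfun_eqI)
    (simp add: hom_part_def sum_words_Suc blinfun.sum_left blinfun.sum_right BH_scaleC[OF assms])

text \<open>Each letter costs one application of the row bound, hence a factor
  \<open>t\<^sup>2\<close>. Treating the row as a whole avoids a factor counting the words.\<close>

lemma norm_hom_apply: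
  assumes BH: "\<And>i. X i \<in> BH" and row: "row_bound X t" and t: "t \<ge> 0"
  shows "(norm (blinfun_apply (hom_part a k X) h))\<^sup>2 \<le> (t ^ k)\<^sup>2 * wt a k * (norm h)\<^sup>2"
proof (induction k arbitrary: a)
  case 0
  then show ?case by (simp add: hom_0 wt_0 norm_scaleC power_mult_distrib)
next
  case (Suc k)
  have "(norm (hom_part a (Suc k) X h))\<^sup>2
      \<le> t\<^sup>2 * (\<Sum>i\<in>UNIV. (norm (hom_part (\<lambda>\<alpha>. a (i # \<alpha>)) k X h))\<^sup>2)"
    using row_boundD[OF row] by (simp add: hom_Suc[OF BH] blinfun.sum_left)
  also have "\<dots> \<le> t\<^sup>2 * (\<Sum>i\<in>UNIV. (t ^ k)\<^sup>2 * wt (\<lambda>\<alpha>. a (i # \<alpha>)) k * (norm h)\<^sup>2)"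
    by (intro mult_left_mono sum_mono Suc.IH) auto
  also have "\<dots> = (t ^ Suc k)\<^sup>2 * wt a (Suc k) * (norm h)\<^sup>2"
    by (simp add: wt_Suc sum_distrib_left sum_distrib_right power_mult_distrib mult_ac)
  finally show ?case .
qed

lemma norm_hom:
  assumes "\<And>i. X i \<in> BH" "row_bound X t" "t \<ge> 0"
  shows "norm (hom_part a k X) \<le> sqrt (wt a k) * t ^ k"
proof (rule norm_blinfun_bound)
  fix h
  have "(norm (hom_part a k X h))\<^sup>2 \<le> (sqrt (wt a k) * t ^ k * norm h)\<^sup>2"
    using norm_hom_apply[OF assms] by (simp add: power_mult_distrib mult_ac)
  then show "norm (hom_part a k X h) \<le> sqrt (wt a k) * t ^ k * norm h"
    by (rule power2_le_imp_le) (use assms in auto)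
qed (use assms in auto)

text \<open>The coefficient sequences of free holomorphic functions, in the form of absolute
  convergence on every smaller ball rather than as a root test.\<close>

definition free_coeffs :: "('n::finite list \<Rightarrow> complex) \<Rightarrow> bool" where
  "free_coeffs a \<longleftrightarrow> (\<forall>r. 0 < r \<and> r < 1 \<longrightarrow> summable (\<lambda>k. sqrt (wt a k) * r ^ k))"

lemma free_coeffs_limsup:
  assumes "limsup (\<lambda>k. ereal (root (2 * k) (wt a k))) \<le> 1"
  shows "free_coeffs a"
  unfolding free_coeffs_def
proof (intro allI impI)
  fix r :: real assume r: "0 < r \<and> r < 1"
  \<comment> \<open>The midpoint of 1 and \<open>1 / r\<close>: it exceeds the limsup, and still
    \<open>R * r < 1\<close>.\<close>
  define R where "R = (1 + 1 / r) / 2"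
  have R: "1 < R" "R * r < 1" "0 < R * r" using r by (auto simp: R_def field_simps add_pos_pos)
  have "limsup (\<lambda>k. ereal (root (2 * k) (wt a k))) < ereal R"
    by (rule le_less_trans[OF assms]) (use R in simp)
  then have "\<forall>\<^sub>F k in sequentially. ereal (root (2 * k) (wt a k)) < ereal R"
    by (rule Limsup_lessD)
  \<comment> \<open>Degree 0 is excluded because \<open>root 0\<close> is constantly 0 and carries
    no information on the weight.\<close>
  then have "\<forall>\<^sub>F k in sequentially. norm (sqrt (wt a k) * r ^ k) \<le> (R * r) ^ k"
    using eventually_gt_at_top[of 0]
  proof eventually_elim
    case (elim k)
    then have "root (2 * k) (wt a k) ^ (2 * k) \<le> R ^ (2 * k)"
      by (intro power_mono) auto
    then have "wt a k \<le> (R ^ k)\<^sup>2" using elim by (simp add: power_mult mult.commute flip: power_mult)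
    then have "sqrt (wt a k) \<le> R ^ k" using R by (intro real_le_lsqrt) auto
    then show ?case using r by (simp add: power_mult_distrib mult_right_mono)
  qed
  then show "summable (\<lambda>k. sqrt (wt a k) * r ^ k)"
    by (rule summable_comparison_test_ev) (use R in auto)
qed

lemma limsup_bounded_wt:
  assumes "\<And>k. wt a k \<le> K"
  shows "limsup (\<lambda>k. ereal (root (2 * k) (wt a k))) \<le> 1"
proof -
  \<comment> \<open>Raising the bound to at least 1 makes it positive, so that its roots tend to
    1.\<close>
  define L where "L = max K 1"
  have L: "L \<ge> 1" "\<And>k. wt a k \<le> L" using assms by (auto simp: L_def max.coboundedI1)
  have "(\<lambda>k. root (2 * k) L) \<longlonglongrightarrow> 1"
    using LIMSEQ_subseq_LIMSEQ[OF LIMSEQ_root_const[of L], of "\<lambda>k. 2 * k"] L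
    by (simp add: o_def strict_mono_def)
  then have lim: "(\<lambda>k. ereal (root (2 * k) L)) \<longlonglongrightarrow> ereal 1" by (intro tendsto_intros) auto
  have "limsup (\<lambda>k. ereal (root (2 * k) (wt a k))) \<le> limsup (\<lambda>k. ereal (root (2 * k) L))"
  proof (rule Limsup_mono, rule eventually_mono[OF eventually_gt_at_top[of 0]])
    fix k :: nat assume "0 < k"
    then show "ereal (root (2 * k) (wt a k)) \<le> ereal (root (2 * k) L)"
      using L(2)[of k] by simp
  qed
  also have "\<dots> = 1" using lim_imp_Limsup[OF _ lim] by (simp add: one_ereal_def)
  finally show ?thesis .
qed

lemma summable_wt_power:
  assumes "free_coeffs a" "0 \<le> t" "t < 1"
  shows "summable (\<lambda>k. sqrt (wt a k) * t ^ k)"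
proof (rule summable_comparison_test)
  show "summable (\<lambda>k. sqrt (wt a k) * ((1 + t) / 2) ^ k)"
    using assms by (simp add: free_coeffs_def)
  show "\<exists>N. \<forall>n\<ge>N. norm (sqrt (wt a n) * t ^ n) \<le> sqrt (wt a n) * ((1 + t) / 2) ^ n"
    using assms by (auto intro!: mult_left_mono power_mono)
qed

lemma summable_norm_hom:
  assumes "free_coeffs a" "X \<in> op_ball"
  shows "summable (\<lambda>k. norm (hom_part a k X))"
proof -
  obtain t where t: "0 \<le> t" "t < 1" "row_bound X t" "\<And>i. X i \<in> BH"
    using assms by (auto simp: op_ball_iff)
  show ?thesis
    by (rule summable_comparison_test'[OF summable_wt_power[OF assms(1) t(1,2)]])
      (use norm_hom[OF t(4,3,1)] in auto)
qed

lemma has_free_series_iff: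
  "has_free_series f a \<longleftrightarrow> limsup (\<lambda>k. ereal (root (2 * k) (wt a k))) \<le> 1 \<and>
     (\<forall>X\<in>op_ball. (\<lambda>k. hom_part a k X) sums f X)"
  by (simp add: has_free_series_def hom_part_def wt_def)

lemma row_bound_scaleR:
  assumes "row_bound X t"
  shows "row_bound (\<lambda>i. r *\<^sub>R X i) (r * t)"
  unfolding row_bound_def
proof
  fix h
  have "(norm (\<Sum>i\<in>UNIV. (r *\<^sub>R X i) (h i)))\<^sup>2 = r\<^sup>2 * (norm (\<Sum>i\<in>UNIV. X i (h i)))\<^sup>2"
    by (simp add: blinfun.scaleR_left power_mult_distrib flip: scaleR_sum_right)
  also have "\<dots> \<le> r\<^sup>2 * (t\<^sup>2 * (\<Sum>i\<in>UNIV. (norm (h i))\<^sup>2))"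
    by (intro mult_left_mono row_boundD assms) auto
  finally show "(norm (\<Sum>i\<in>UNIV. (r *\<^sub>R X i) (h i)))\<^sup>2 \<le> (r * t)\<^sup>2 * (\<Sum>i\<in>UNIV. (norm (h i))\<^sup>2)"
    by (simp add: power_mult_distrib mult_ac)
qed

section \<open>Coefficients read off at the scaled creation operators\<close>

context free_shift
begin

lemma norm_e [simp]: "norm (e \<alpha>) = 1"
  using orth by (simp add: norm_eq_sqrt_cinner orthonormal_def)

text \<open>\<open>S\<close> itself has only the row bound 1; scaling by \<open>r < 1\<close> moves
  it into the open ball.\<close>

definition rS :: "real \<Rightarrow> 'n \<Rightarrow> ('h \<Rightarrow>\<^sub>L 'h)" where
  "rS r i = r *\<^sub>R S i"

lemma rS_BH: "rS r i \<in> BH"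
  using BH by (auto simp: rS_def BH_def blinfun.scaleR_left scaleR_scaleC scaleC_scaleC mult.commute)

lemma rS_row: "row_bound (rS r) r"
  using row_bound_scaleR[OF row, of r] by (simp add: rS_def[abs_def])

lemma rS_op_ball: "0 \<le> r \<Longrightarrow> r < 1 \<Longrightarrow> rS r \<in> op_ball"
  using rS_row rS_BH by (auto simp: op_ball_iff)

lemma word_op_rS: "blinfun_apply (word_op (rS r) \<alpha>) (e []) = complex_of_real (r ^ length \<alpha>) *\<^sub>C e \<alpha>"
  by (induction \<alpha>)
    (simp_all add: scaleC_one rS_def blinfun.scaleR_left BH_scaleC[OF BH] shift scaleR_scaleC scaleC_scaleC)

lemma cinner_hom_rS:
  "cinner (blinfun_apply (hom_part a k (rS r)) (e [])) (e \<gamma>)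
    = (if length \<gamma> = k then complex_of_real (r ^ k) * a \<gamma> else 0)"
proof -
  have "hom_part a k (rS r) (e []) = (\<Sum>\<alpha> | length \<alpha> = k. (a \<alpha> * complex_of_real (r ^ k)) *\<^sub>C e \<alpha>)"
    by (simp add: hom_part_def blinfun.sum_left word_op_rS scaleC_scaleC)
  then show ?thesis by (simp add: cinner_orthonormal_sum[OF orth] mult.commute)
qed

text \<open>Distinct words send the vacuum to multiples of distinct basis vectors, so pairing with
  \<open>e \<gamma>\<close> isolates one coefficient.\<close>

lemma cinner_series_rS:
  assumes "(\<lambda>k. hom_part a k (rS r)) sums T"
  shows "cinner (blinfun_apply T (e [])) (e \<gamma>) = complex_of_real (r ^ length \<gamma>) * a \<gamma>"
proof -
  have "bounded_linear (\<lambda>T. cinner (blinfun_apply T (e [])) (e \<gamma>))"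
    by (rule bounded_linear_compose[OF bounded_linear_cinner_left blinfun.bounded_linear_left])
  from bounded_linear.sums[OF this assms]
  have "(\<lambda>k. if k = length \<gamma> then complex_of_real (r ^ k) * a \<gamma> else 0)
      sums cinner (blinfun_apply T (e [])) (e \<gamma>)"
    by (simp add: cinner_hom_rS eq_commute cong: if_cong)
  then show ?thesis
    using sums_unique2 sums_single[of "length \<gamma>" "\<lambda>k. complex_of_real (r ^ k) * a \<gamma>"] by blast
qed

text \<open>Gives meaning to the \<open>THE\<close> in \<open>free_coeff\<close>.\<close>

lemma free_series_unique:
  fixes f :: "('n \<Rightarrow> ('h \<Rightarrow>\<^sub>L 'h)) \<Rightarrow> ('h \<Rightarrow>\<^sub>L 'h)"
  assumes "has_free_series f a" "has_free_series f b"
  shows "a = b"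
proof
  fix \<gamma>
  have "(\<lambda>k. hom_part c k (rS (1/2))) sums f (rS (1/2))" if "has_free_series f c" for c :: "'n list \<Rightarrow> complex"
    using that rS_op_ball[of "1/2"] by (simp add: has_free_series_iff)
  from cinner_series_rS[OF this[OF assms(1)], of \<gamma>] cinner_series_rS[OF this[OF assms(2)], of \<gamma>]
  show "a \<gamma> = b \<gamma>" by simp
qed

lemma free_coeff_eq: "has_free_series f a \<Longrightarrow> free_coeff f = a"
  for f :: "('n \<Rightarrow> ('h \<Rightarrow>\<^sub>L 'h)) \<Rightarrow> ('h \<Rightarrow>\<^sub>L 'h)"
  unfolding free_coeff_def using free_series_unique by blast

lemma Bessel_series_rS:
  assumes "(\<lambda>k. hom_part a k (rS r)) sums T" "finite F"
  shows "(\<Sum>\<gamma>\<in>F. r ^ (2 * length \<gamma>) * (cmod (a \<gamma>))\<^sup>2) \<le> (norm (blinfun_apply T (e [])))\<^sup>2"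
proof -
  have "r ^ (2 * length \<gamma>) * (cmod (a \<gamma>))\<^sup>2 = (cmod (cinner (T (e [])) (e \<gamma>)))\<^sup>2" for \<gamma>
    unfolding cinner_series_rS[OF assms(1)] norm_mult norm_of_real power_mult_distrib power2_abs
    by (simp add: mult.commute flip: power_mult)
  then show ?thesis using Bessel[OF orth assms(2)] by simp
qed

lemma wt_le_norm:
  assumes "(\<lambda>k. hom_part a k (rS r)) sums T"
  shows "r ^ (2 * k) * wt a k \<le> (norm (blinfun_apply T (e [])))\<^sup>2"
proof -
  have "r ^ (2 * k) * wt a k = (\<Sum>\<gamma> | length \<gamma> = k. r ^ (2 * length \<gamma>) * (cmod (a \<gamma>))\<^sup>2)"
    by (simp add: wt_def sum_distrib_left)
  also have "\<dots> \<le> (norm (T (e [])))\<^sup>2" by (rule Bessel_series_rS[OF assms]) simp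
  finally show ?thesis .
qed

end

subsection \<open>Products and composition\<close>

text \<open>Coefficients of a product of two series: the sum over all splittings of a word into a
  prefix for \<open>p\<close> and a suffix for \<open>q\<close>. In the second equation the prefix
  is either empty or starts with \<open>i\<close>.\<close>

primrec free_conv :: "('n list \<Rightarrow> complex) \<Rightarrow> ('n list \<Rightarrow> complex) \<Rightarrow> 'n list \<Rightarrow> complex" where
  free_conv_Nil: "free_conv p q [] = p [] * q []"
| free_conv_Cons: "free_conv p q (i # \<gamma>) = p [] * q (i # \<gamma>) + free_conv (\<lambda>\<alpha>. p (i # \<alpha>)) q \<gamma>"

lemma hom_lincomb: "hom_part (\<lambda>\<alpha>. c * a \<alpha> + b \<alpha>) k X = c *\<^sub>O hom_part a k X + hom_part b k X"
  by (rule blinfun_eqI)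
    (simp add: hom_part_def blinfun.sum_left blinfun.add_left scaleC_add_left sum.distrib
      scaleC_scaleC complex_vector.scale_sum_right)

lemma hom_sum: "hom_part (\<lambda>\<alpha>. \<Sum>i\<in>I. a i \<alpha>) k X = (\<Sum>i\<in>I. hom_part (a i) k X)"
  by (rule blinfun_eqI)
    (simp add: hom_part_def blinfun.sum_left complex_vector.scale_sum_left sum.swap[of _ I])

lemma hom_free_conv:
  assumes BH: "\<And>i. X i \<in> BH"
  shows "hom_part (free_conv p q) m X = (\<Sum>j\<le>m. hom_part p j X o\<^sub>L hom_part q (m - j) X)"
proof (induction m arbitrary: p)
  case 0
  show ?case by (rule blinfun_eqI) (simp add: hom_0 scaleC_scaleC)
next
  case (Suc m)
  have "hom_part (free_conv p q) (Suc m) X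
      = (\<Sum>i\<in>UNIV. X i o\<^sub>L (p [] *\<^sub>O hom_part (\<lambda>\<gamma>. q (i # \<gamma>)) m X + hom_part (free_conv (\<lambda>\<alpha>. p (i # \<alpha>)) q) m X))"
    by (simp add: hom_Suc[OF BH] hom_lincomb)
  \<comment> \<open>The terms with empty prefix reassemble to the degree \<open>Suc m\<close> part
    of \<open>q\<close>; the others are covered by the induction hypothesis for \<open>p\<close>
    with its first letter removed.\<close>
  also have "\<dots> = p [] *\<^sub>O hom_part q (Suc m) X
      + (\<Sum>j\<le>m. hom_part p (Suc j) X o\<^sub>L hom_part q (m - j) X)"
    by (rule blinfun_eqI)
      (simp add: Suc.IH hom_Suc[OF BH] blinfun.sum_left blinfun.sum_right blinfun.add_left
        blinfun.add_right BH_scaleC[OF BH] sum.distrib complex_vector.scale_sum_right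
        sum.swap[of _ "{..m}"])
  also have "p [] *\<^sub>O hom_part q (Suc m) X = hom_part p 0 X o\<^sub>L hom_part q (Suc m) X"
    by (rule blinfun_eqI) (simp add: hom_0)
  finally show ?case by (subst sum.atMost_Suc_shift) simp
qed

section \<open>Double series with a product majorant\<close>

lemma summable_on_product_bound:
  fixes u :: "nat \<Rightarrow> nat \<Rightarrow> 'b::banach"
  assumes "summable B" "summable C" "\<And>k m. norm (u k m) \<le> B k * C m"
    and nonneg: "\<And>k. B k \<ge> 0" "\<And>m. C m \<ge> 0"
  shows "(\<lambda>(k, m). u k m) summable_on UNIV \<times> UNIV"
proof -
  have B: "B summable_on UNIV" and C: "C summable_on UNIV"
    using assms by (auto intro!: norm_summable_imp_summable_on)
  have "(\<lambda>p. norm (case p of (k, m) \<Rightarrow> B k * C m)) summable_on UNIV \<times> UNIV"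
    by (rule iffD2[OF Infinite_Sum.abs_summable_on_Sigma_iff[where f = "\<lambda>(k, m). B k * C m"]])
      (use B C nonneg in \<open>auto simp: abs_mult infsum_cmult_right' intro!: summable_on_cmult_right summable_on_cmult_left\<close>)
  then have "(\<lambda>p. norm (case p of (k, m) \<Rightarrow> u k m)) summable_on UNIV \<times> UNIV"
    by (rule Infinite_Sum.abs_summable_on_comparison_test)
      (use assms(3) nonneg in \<open>auto simp: abs_mult split: prod.split\<close>)
  then show ?thesis by (rule abs_summable_summable)
qed

text \<open>Fubini for series: both iterated sums equal the unordered sum \<open>T\<close> over all
  pairs.\<close>

lemma sums_swap:
  fixes u :: "nat \<Rightarrow> nat \<Rightarrow> 'b::banach"
  assumes "summable B" "summable C" "\<And>k m. norm (u k m) \<le> B k * C m"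
    and "\<And>k. B k \<ge> 0" "\<And>m. C m \<ge> 0"
    and v: "\<And>k. u k sums v k" "v sums V" and w: "\<And>m. (\<lambda>k. u k m) sums w m"
  shows "w sums V"
proof -
  have hs: "(f has_sum s) UNIV" if "f sums s" "summable D" "\<And>n. norm (f n) \<le> D n"
    for f :: "nat \<Rightarrow> 'b" and s D
    using that by (intro norm_summable_imp_has_sum summable_comparison_test'[OF that(2)]) auto
  obtain T where T: "((\<lambda>(k, m). u k m) has_sum T) (UNIV \<times> UNIV)"
    using summable_on_product_bound[OF assms(1-5)] by (auto simp: summable_on_def)
  have "(v has_sum T) UNIV"
  proof (rule has_sum_SigmaD[OF T])
    fix k show "((\<lambda>m. case (k, m) of (k, m) \<Rightarrow> u k m) has_sum v k) UNIV"
      using hs[OF v(1) summable_mult[OF assms(2)] assms(3)] by simp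
  qed
  then have "T = V" using v(2) has_sum_imp_sums sums_unique2 by blast
  have T': "((\<lambda>(m, k). u k m) has_sum T) (UNIV \<times> UNIV)"
    using T by (subst has_sum_swap) (simp add: case_prod_unfold)
  have "(w has_sum T) UNIV"
  proof (rule has_sum_SigmaD[OF T'])
    fix m show "((\<lambda>k. case (m, k) of (m, k) \<Rightarrow> u k m) has_sum w m) UNIV"
      using hs[OF w summable_mult2[OF assms(1)] assms(3)] by simp
  qed
  then show ?thesis using \<open>T = V\<close> has_sum_imp_sums by blast
qed

lemma Cauchy_product_blinfun_sums:
  fixes f g :: "nat \<Rightarrow> ('b::banach \<Rightarrow>\<^sub>L 'b)"
  assumes f: "f sums F" "summable (\<lambda>k. norm (f k))" and g: "g sums G" "summable (\<lambda>k. norm (g k))"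
  shows "(\<lambda>m. \<Sum>j\<le>m. f j o\<^sub>L g (m - j)) sums (F o\<^sub>L G)"
proof -
  obtain T where T: "((\<lambda>(j, k). f j o\<^sub>L g k) has_sum T) (UNIV \<times> UNIV)"
    using summable_on_product_bound[OF f(2) g(2), of "\<lambda>j k. f j o\<^sub>L g k"]
    by (auto simp: summable_on_def norm_blinfun_compose)
  have "((\<lambda>j. f j o\<^sub>L G) has_sum T) UNIV"
  proof (rule has_sum_SigmaD[OF T])
    fix j show "((\<lambda>k. case (j, k) of (j, k) \<Rightarrow> f j o\<^sub>L g k) has_sum f j o\<^sub>L G) UNIV"
      using has_sum_bounded_linear[OF bounded_bilinear.bounded_linear_right[OF bounded_bilinear_blinfun_compose]
          norm_summable_imp_has_sum[OF g(2,1)]] by (simp add: o_def)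
  qed
  moreover have "(\<lambda>j. f j o\<^sub>L G) sums (F o\<^sub>L G)"
    by (rule bounded_linear.sums[OF bounded_bilinear.bounded_linear_left[OF bounded_bilinear_blinfun_compose] f(1)])
  ultimately have "T = F o\<^sub>L G" using has_sum_imp_sums sums_unique2 by blast
  \<comment> \<open>Reindexing by total degree \<open>m\<close> regroups the double sum along
    antidiagonals.\<close>
  have bij: "bij_betw (\<lambda>(m, j). (j, m - j)) (SIGMA m:UNIV. {..m}) (UNIV \<times> UNIV :: (nat \<times> nat) set)"
    by (rule bij_betwI[where g = "\<lambda>(j, k). (j + k, j)"]) auto
  have "((\<lambda>(m, j). f j o\<^sub>L g (m - j)) has_sum T) (SIGMA m:UNIV. {..m})"
    using T by (subst (asm) has_sum_reindex_bij_betw[OF bij, symmetric]) (simp add: case_prod_unfold)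
  then have "((\<lambda>m. \<Sum>j\<le>m. f j o\<^sub>L g (m - j)) has_sum T) UNIV"
    by (rule has_sum_SigmaD) (simp add: has_sum_finite)
  then show ?thesis using \<open>T = F o\<^sub>L G\<close> has_sum_imp_sums by blast
qed

lemma bounded_linear_op_scaleC: "bounded_linear (\<lambda>c. c *\<^sub>O T)"
proof (rule bounded_linear_intro[where K = "norm T"])
  show "norm (c *\<^sub>O T) \<le> norm c * norm T" for c
    by (rule norm_blinfun_bound) (auto simp: norm_scaleC mult.assoc intro!: mult_left_mono norm_blinfun)
qed (auto intro!: blinfun_eqI simp: scaleC_add_left blinfun.add_left blinfun.scaleR_left scaleR_scaleC
      scaleC_scaleC scaleR_conv_of_real)

text \<open>\<open>has_free_series\<close> with the root test weakened to
  \<open>free_coeffs\<close>, a condition that majorant series transfer directly to sums and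
  products.\<close>

definition free_expansion ::
  "(('n::finite \<Rightarrow> ('h::complex_hilbert \<Rightarrow>\<^sub>L 'h)) \<Rightarrow> ('h \<Rightarrow>\<^sub>L 'h)) \<Rightarrow> ('n list \<Rightarrow> complex) \<Rightarrow> bool" where
  "free_expansion f a \<longleftrightarrow> free_coeffs a \<and> (\<forall>X\<in>op_ball. (\<lambda>k. hom_part a k X) sums f X)"

lemma has_free_series_expansion: "has_free_series f a \<Longrightarrow> free_expansion f a"
  by (simp add: free_expansion_def has_free_series_iff free_coeffs_limsup)

lemma free_self_map_op_ball: "free_self_map \<phi> \<Longrightarrow> X \<in> op_ball \<Longrightarrow> \<phi> X \<in> op_ball"
  by (simp add: free_self_map_def)

lemma free_expansion_cong:
  "(\<And>X. X \<in> op_ball \<Longrightarrow> f X = g X) \<Longrightarrow> free_expansion f a \<longleftrightarrow> free_expansion g a"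
  by (simp add: free_expansion_def)

section \<open>Closure under products and substitution\<close>

context free_shift
begin

text \<open>At \<open>S\<close> on the vacuum the estimate of \<open>norm_hom\<close> is attained,
  so inequalities between weights can be proved as norm inequalities.\<close>

lemma norm_hom_vacuum: "norm (blinfun_apply (hom_part a k S) (e [])) = sqrt (wt a k)"
proof -
  have S: "rS 1 = S" by (simp add: rS_def[abs_def])
  have "hom_part a k S (e []) = (\<Sum>\<alpha> | length \<alpha> = k. a \<alpha> *\<^sub>C e \<alpha>)"
    using word_op_rS[of 1] by (simp add: S hom_part_def blinfun.sum_left scaleC_one)
  then have "(norm (hom_part a k S (e [])))\<^sup>2 = wt a k"
    by (simp add: norm_orthonormal_sum[OF orth] wt_def)
  then show ?thesis by (metis norm_ge_zero real_sqrt_abs2 real_sqrt_unique)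
qed

text \<open>The product is evaluated at \<open>S\<close> on the vacuum: the right factors give their
  weights exactly, the left factors are bounded by \<open>norm_hom\<close> with row bound 1.\<close>

lemma sqrt_wt_free_conv: "sqrt (wt (free_conv p q) m) \<le> (\<Sum>j\<le>m. sqrt (wt p j) * sqrt (wt q (m - j)))"
  for p q :: "'n list \<Rightarrow> complex"
proof -
  have "sqrt (wt (free_conv p q) m) = norm (\<Sum>j\<le>m. hom_part p j S (hom_part q (m - j) S (e [])))"
    unfolding norm_hom_vacuum[symmetric] hom_free_conv[OF BH] by (simp add: blinfun.sum_left)
  also have "\<dots> \<le> (\<Sum>j\<le>m. norm (hom_part p j S) * norm (hom_part q (m - j) S (e [])))"
    by (rule sum_norm_le) (rule norm_blinfun)
  also have "\<dots> \<le> (\<Sum>j\<le>m. sqrt (wt p j) * sqrt (wt q (m - j)))"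
    unfolding norm_hom_vacuum
    using norm_hom[OF BH row, of p] by (intro sum_mono mult_right_mono) auto
  finally show ?thesis .
qed

lemma sqrt_wt_sum: "sqrt (wt (\<lambda>\<alpha>. \<Sum>i\<in>I. p i \<alpha>) k) \<le> (\<Sum>i\<in>I. sqrt (wt (p i) k))"
  for p :: "'i \<Rightarrow> 'n list \<Rightarrow> complex"
  unfolding norm_hom_vacuum[symmetric] hom_sum blinfun.sum_left by (rule norm_sum)

lemma free_expansion_compose:
  fixes f g :: "('n \<Rightarrow> ('h \<Rightarrow>\<^sub>L 'h)) \<Rightarrow> ('h \<Rightarrow>\<^sub>L 'h)"
  assumes f: "free_expansion f p" and g: "free_expansion g q"
  shows "free_expansion (\<lambda>X. f X o\<^sub>L g X) (free_conv p q)"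
  unfolding free_expansion_def
proof
  show "free_coeffs (free_conv p q)"
    unfolding free_coeffs_def
  proof (intro allI impI)
    fix r :: real assume r: "0 < r \<and> r < 1"
    have "summable (\<lambda>m. \<Sum>j\<le>m. (sqrt (wt p j) * r ^ j) * (sqrt (wt q (m - j)) * r ^ (m - j)))"
      by (rule summable_Cauchy_product)
        (use f g r in \<open>auto simp: free_expansion_def free_coeffs_def abs_mult\<close>)
    then show "summable (\<lambda>m. sqrt (wt (free_conv p q) m) * r ^ m)"
    proof (rule summable_comparison_test')
      fix m :: nat
      have "sqrt (wt (free_conv p q) m) * r ^ m \<le> (\<Sum>j\<le>m. sqrt (wt p j) * sqrt (wt q (m - j))) * r ^ m"
        using r by (intro mult_right_mono sqrt_wt_free_conv) auto
      also have "\<dots> = (\<Sum>j\<le>m. (sqrt (wt p j) * r ^ j) * (sqrt (wt q (m - j)) * r ^ (m - j)))"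
        unfolding sum_distrib_right
      proof (intro sum.cong refl)
        fix j assume "j \<in> {..m}"
        then have "r ^ m = r ^ j * r ^ (m - j)" by (simp flip: power_add)
        then show "sqrt (wt p j) * sqrt (wt q (m - j)) * r ^ m
            = (sqrt (wt p j) * r ^ j) * (sqrt (wt q (m - j)) * r ^ (m - j))" by simp
      qed
      finally show "norm (sqrt (wt (free_conv p q) m) * r ^ m)
          \<le> (\<Sum>j\<le>m. (sqrt (wt p j) * r ^ j) * (sqrt (wt q (m - j)) * r ^ (m - j)))"
        using r by simp
    qed
  qed
next
  show "\<forall>X\<in>op_ball. (\<lambda>k. hom_part (free_conv p q) k X) sums (f X o\<^sub>L g X)"
  proof
    fix X :: "'n \<Rightarrow> ('h \<Rightarrow>\<^sub>L 'h)" assume X: "X \<in> op_ball"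
    then have X': "X i \<in> BH" for i by (simp add: op_ball_iff)
    show "(\<lambda>k. hom_part (free_conv p q) k X) sums (f X o\<^sub>L g X)"
      unfolding hom_free_conv[OF X']
      using f g X by (intro Cauchy_product_blinfun_sums summable_norm_hom) (auto simp: free_expansion_def)
  qed
qed

lemma free_expansion_sum:
  fixes f :: "'i \<Rightarrow> ('n \<Rightarrow> ('h \<Rightarrow>\<^sub>L 'h)) \<Rightarrow> ('h \<Rightarrow>\<^sub>L 'h)"
  assumes f: "\<And>i. i \<in> I \<Longrightarrow> free_expansion (f i) (p i)"
  shows "free_expansion (\<lambda>X. \<Sum>i\<in>I. f i X) (\<lambda>\<alpha>. \<Sum>i\<in>I. p i \<alpha>)"
  unfolding free_expansion_def
proof
  show "free_coeffs (\<lambda>\<alpha>. \<Sum>i\<in>I. p i \<alpha>)"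
    unfolding free_coeffs_def
  proof (intro allI impI)
    fix r :: real assume r: "0 < r \<and> r < 1"
    have "summable (\<lambda>k. \<Sum>i\<in>I. sqrt (wt (p i) k) * r ^ k)"
      by (rule summable_sum) (use f r in \<open>auto simp: free_expansion_def free_coeffs_def\<close>)
    then show "summable (\<lambda>k. sqrt (wt (\<lambda>\<alpha>. \<Sum>i\<in>I. p i \<alpha>) k) * r ^ k)"
      by (rule summable_comparison_test')
        (use r in \<open>auto simp: sum_distrib_right[symmetric] intro!: mult_right_mono sqrt_wt_sum\<close>)
  qed
  show "\<forall>X\<in>op_ball. (\<lambda>k. hom_part (\<lambda>\<alpha>. \<Sum>i\<in>I. p i \<alpha>) k X) sums (\<Sum>i\<in>I. f i X)"
    unfolding hom_sum using f by (auto simp: free_expansion_def intro!: sums_sum)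
qed

lemma free_expansion_const:
  "free_expansion (\<lambda>X :: 'n \<Rightarrow> ('h \<Rightarrow>\<^sub>L 'h). c *\<^sub>O id_blinfun) (\<lambda>\<alpha>. if \<alpha> = [] then c else 0)"
proof -
  have wt: "wt (\<lambda>\<alpha> :: 'n list. if \<alpha> = [] then c else 0) k = (if k = 0 then (cmod c)\<^sup>2 else 0)" for k
    by (cases k) (simp_all add: wt_0 wt_Suc, simp add: wt_def)
  have hom_part: "hom_part (\<lambda>\<alpha> :: 'n list. if \<alpha> = [] then c else 0) k X
      = (if k = 0 then c *\<^sub>O id_blinfun else 0)" for k and X :: "'n \<Rightarrow> ('h \<Rightarrow>\<^sub>L 'h)"
  proof (cases k)
    case (Suc l)
    have "hom_part (\<lambda>\<alpha> :: 'n list. if \<alpha> = [] then c else 0) k X x = 0" for x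
      unfolding hom_part_def blinfun.sum_left
      by (rule sum.neutral) (auto simp: Suc complex_vector.scale_zero_left)
    then show ?thesis using Suc by (auto intro!: blinfun_eqI)
  qed (simp add: hom_0)
  show ?thesis
    unfolding free_expansion_def free_coeffs_def
  proof (intro conjI allI impI ballI)
    fix r :: real
    show "summable (\<lambda>k. sqrt (wt (\<lambda>\<alpha> :: 'n list. if \<alpha> = [] then c else 0) k) * r ^ k)"
      by (rule summable_finite[of "{0}"]) (auto simp: wt)
  next
    fix X :: "'n \<Rightarrow> ('h \<Rightarrow>\<^sub>L 'h)"
    show "(\<lambda>k. hom_part (\<lambda>\<alpha> :: 'n list. if \<alpha> = [] then c else 0) k X) sums (c *\<^sub>O id_blinfun)"
      using sums_single[of 0 "\<lambda>_. c *\<^sub>O (id_blinfun :: 'h \<Rightarrow>\<^sub>L 'h)"] by (simp add: hom_part)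
  qed
qed

lemma free_expansion_hom_comp:
  fixes \<phi> :: "('n \<Rightarrow> ('h \<Rightarrow>\<^sub>L 'h)) \<Rightarrow> ('n \<Rightarrow> ('h \<Rightarrow>\<^sub>L 'h))"
  assumes \<phi>: "free_self_map \<phi>"
  shows "\<exists>q. free_expansion (\<lambda>X. hom_part a k (\<phi> X)) q"
proof (induction k arbitrary: a)
  case 0
  show ?case unfolding hom_0 using free_expansion_const by blast
next
  case (Suc k)
  have "\<forall>i. \<exists>p. free_expansion (\<lambda>X. \<phi> X i) p"
    using \<phi> has_free_series_expansion unfolding free_self_map_def free_holomorphic_def by blast
  from choice[OF this] obtain p where p: "\<And>i. free_expansion (\<lambda>X. \<phi> X i) (p i)" by blast
  have "\<forall>i. \<exists>q. free_expansion (\<lambda>X. hom_part (\<lambda>\<alpha>. a (i # \<alpha>)) k (\<phi> X)) q"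
    using Suc.IH by blast
  from choice[OF this]
  obtain q where q: "\<And>i. free_expansion (\<lambda>X. hom_part (\<lambda>\<alpha>. a (i # \<alpha>)) k (\<phi> X)) (q i)"
    by blast
  have "free_expansion (\<lambda>X. \<Sum>i\<in>UNIV. \<phi> X i o\<^sub>L hom_part (\<lambda>\<alpha>. a (i # \<alpha>)) k (\<phi> X))
      (\<lambda>\<alpha>. \<Sum>i\<in>UNIV. free_conv (p i) (q i) \<alpha>)"
    by (intro free_expansion_sum free_expansion_compose p q)
  also have "?this \<longleftrightarrow> free_expansion (\<lambda>X. hom_part a (Suc k) (\<phi> X)) (\<lambda>\<alpha>. \<Sum>i\<in>UNIV. free_conv (p i) (q i) \<alpha>)"
    using free_self_map_op_ball[OF \<phi>]
    by (intro free_expansion_cong hom_Suc[symmetric]) (auto simp: op_ball_iff)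
  finally show ?case by blast
qed

text \<open>
  The coefficient of \<open>\<gamma>\<close> in \<open>f \<circ> \<phi>\<close> sums those of \<open>P\<^sub>k \<circ> \<phi>\<close>, \<open>P\<^sub>k\<close> the homogeneous parts of \<open>f\<close>. The
  interchange of sums is justified by evaluating at \<open>r S\<close>: as \<open>\<phi> (r S)\<close> has row norm \<open>t < 1\<close>, the
  degree \<open>m\<close> part of \<open>P\<^sub>k \<circ> \<phi>\<close> has coefficient norm at most \<open>\<parallel>P\<^sub>k\<parallel>\<^sub>2 t\<^sup>k / r\<^sup>m\<close>.
\<close>

lemma comp_expansion:
  fixes \<phi> :: "('n \<Rightarrow> ('h \<Rightarrow>\<^sub>L 'h)) \<Rightarrow> ('n \<Rightarrow> ('h \<Rightarrow>\<^sub>L 'h))"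
  assumes \<phi>: "free_self_map \<phi>" and f: "free_expansion f a"
  shows "\<exists>c. \<forall>X\<in>op_ball. (\<lambda>m. hom_part c m X) sums f (\<phi> X)"
proof -
  have "\<forall>k. \<exists>q. free_expansion (\<lambda>X. hom_part a k (\<phi> X)) q"
    using free_expansion_hom_comp[OF \<phi>] by blast
  from choice[OF this]
  obtain q where q: "\<And>k. free_expansion (\<lambda>X. hom_part a k (\<phi> X)) (q k)"
    by blast
  have ex: "\<exists>B. summable B \<and> (\<forall>k. B k \<ge> 0) \<and> (\<forall>k m. sqrt (wt (q k) m) * r ^ m \<le> B k)"
    if r: "0 < r" "r < 1" for r
  proof -
    have "rS r \<in> op_ball" by (rule rS_op_ball) (use r in auto)
    moreover from this have "\<phi> (rS r) \<in> op_ball" by (rule free_self_map_op_ball[OF \<phi>])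
    then obtain t where t: "0 \<le> t" "t < 1" "row_bound (\<phi> (rS r)) t" "\<And>i. \<phi> (rS r) i \<in> BH"
      by (auto simp: op_ball_iff)
    ultimately have "r ^ (2 * m) * wt (q k) m \<le> (norm (hom_part a k (\<phi> (rS r)) (e [])))\<^sup>2" for k m
      using q by (intro wt_le_norm) (auto simp: free_expansion_def)
    also have "(norm (hom_part a k (\<phi> (rS r)) (e [])))\<^sup>2 \<le> (sqrt (wt a k) * t ^ k)\<^sup>2" for k
      using norm_hom_apply[OF t(4,3,1), of a k "e []"] by (simp add: power_mult_distrib mult_ac)
    finally have "(sqrt (wt (q k) m) * r ^ m)\<^sup>2 \<le> (sqrt (wt a k) * t ^ k)\<^sup>2" for k m
      by (simp add: power_mult_distrib power_mult mult.commute flip: power_mult)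
    then have "sqrt (wt (q k) m) * r ^ m \<le> sqrt (wt a k) * t ^ k" for k m
      by (rule power2_le_imp_le) (use t in auto)
    moreover have "summable (\<lambda>k. sqrt (wt a k) * t ^ k)"
      using f t by (auto simp: free_expansion_def intro!: summable_wt_power)
    ultimately show ?thesis using t by (intro exI[of _ "\<lambda>k. sqrt (wt a k) * t ^ k"]) auto
  qed
  define c where "c \<gamma> = (\<Sum>k. q k \<gamma>)" for \<gamma>
  have c: "(\<lambda>k. q k \<gamma>) sums c \<gamma>" for \<gamma>
  proof -
    \<comment> \<open>Any fixed radius would do here; 1/2 turns the estimate into the factor
      \<open>2 ^ length \<gamma>\<close>.\<close>
    obtain B where B: "summable B" "\<And>k m. sqrt (wt (q k) m) * (1/2) ^ m \<le> B k"
      using ex[of "1/2"] by auto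
    have "summable (\<lambda>k. q k \<gamma>)"
    proof (rule summable_comparison_test')
      show "summable (\<lambda>k. B k * 2 ^ length \<gamma>)" using B by (intro summable_mult2)
      fix k
      have "(cmod (q k \<gamma>))\<^sup>2 \<le> wt (q k) (length \<gamma>)"
        unfolding wt_def by (rule member_le_sum) auto
      then have "cmod (q k \<gamma>) \<le> sqrt (wt (q k) (length \<gamma>))" by (rule real_le_rsqrt)
      also have "\<dots> \<le> B k * 2 ^ length \<gamma>"
        using B(2)[of k "length \<gamma>"] by (simp add: field_simps)
      finally show "norm (q k \<gamma>) \<le> B k * 2 ^ length \<gamma>" .
    qed
    then show ?thesis unfolding c_def by (rule summable_sums)
  qed
  show ?thesis
  proof (intro exI ballI)
    fix X :: "'n \<Rightarrow> ('h \<Rightarrow>\<^sub>L 'h)" assume X: "X \<in> op_ball"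
    then obtain s where s: "0 \<le> s" "s < 1" "row_bound X s" "\<And>i. X i \<in> BH"
      by (auto simp: op_ball_iff)
    \<comment> \<open>A radius strictly between \<open>s\<close> and 1: then \<open>B\<close> is
      summable over \<open>k\<close> and the powers of \<open>s / r\<close> over \<open>m\<close>,
      as \<open>sums_swap\<close> demands.\<close>
    define r where "r = (1 + s) / 2"
    have r: "0 < r" "r < 1" "s < r" using s by (auto simp: r_def)
    obtain B where B: "summable B" "\<And>k. B k \<ge> 0" "\<And>k m. sqrt (wt (q k) m) * r ^ m \<le> B k"
      using ex[OF r(1,2)] by auto
    show "(\<lambda>m. hom_part c m X) sums f (\<phi> X)"
    proof (rule sums_swap)
      show "summable B" "summable (\<lambda>m. (s / r) ^ m)" using B s r by auto
      show "norm (hom_part (q k) m X) \<le> B k * (s / r) ^ m" for k m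
      proof -
        have "norm (hom_part (q k) m X) \<le> sqrt (wt (q k) m) * s ^ m" by (rule norm_hom[OF s(4,3,1)])
        also have "\<dots> = (sqrt (wt (q k) m) * r ^ m) * (s / r) ^ m"
          using r by (simp add: power_divide)
        also have "\<dots> \<le> B k * (s / r) ^ m" using B s r by (intro mult_right_mono) auto
        finally show ?thesis .
      qed
      show "B k \<ge> 0" "(s / r) ^ m \<ge> 0" for k m using B s r by auto
      show "(\<lambda>m. hom_part (q k) m X) sums hom_part a k (\<phi> X)" for k
        using q X by (simp add: free_expansion_def)
      show "(\<lambda>k. hom_part a k (\<phi> X)) sums f (\<phi> X)"
        using f free_self_map_op_ball[OF \<phi> X] by (simp add: free_expansion_def)
      show "(\<lambda>k. hom_part (q k) m X) sums hom_part c m X" for m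
        unfolding hom_part_def
        by (intro sums_sum bounded_linear.sums[OF bounded_linear_op_scaleC] c)
    qed
  qed
qed

end

subsection \<open>Littlewood subordination\<close>

definition psum :: "('n::finite list \<Rightarrow> complex) \<Rightarrow> nat \<Rightarrow> ('n \<Rightarrow> ('h::complex_hilbert \<Rightarrow>\<^sub>L 'h)) \<Rightarrow> ('h \<Rightarrow>\<^sub>L 'h)" where
  "psum a N X = (\<Sum>k\<le>N. hom_part a k X)"

lemma psum_Suc:
  assumes "\<And>i. X i \<in> BH"
  shows "psum a (Suc N) X = a [] *\<^sub>O id_blinfun + (\<Sum>i\<in>UNIV. X i o\<^sub>L psum (\<lambda>\<alpha>. a (i # \<alpha>)) N X)"
  unfolding psum_def
  by (subst sum.atMost_Suc_shift)
    (auto intro!: blinfun_eqI simp: hom_0 hom_Suc[OF assms] blinfun.sum_left blinfun.sum_right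
      blinfun.add_left sum.swap[of _ UNIV])

text \<open>The factor \<open>\<rho>\<close> in front of the extra term is the one for which the induction step reduces
  to the nonnegativity of the perfect square \<open>(y - (1 - \<rho>) x)\<^sup>2\<close>.\<close>

lemma norm_psum_vacuum:
  fixes X :: "'n::finite \<Rightarrow> ('h::complex_hilbert \<Rightarrow>\<^sub>L 'h)"
  assumes BH: "\<And>i. X i \<in> BH" and row: "row_bound X 1"
    and u: "norm u = 1" and eig: "\<And>i h. cinner (blinfun_apply (X i) h) u = l i * cinner h u"
    and \<rho>: "(\<Sum>i\<in>UNIV. (cmod (l i))\<^sup>2) = \<rho>\<^sup>2" "0 \<le> \<rho>" "\<rho> < 1"
  shows "(norm (blinfun_apply (psum a N X) u))\<^sup>2 + \<rho> * (cmod (cinner (blinfun_apply (psum a N X) u) u))\<^sup>2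
    \<le> (1 + \<rho>) / (1 - \<rho>) * (\<Sum>k\<le>N. wt a k)"
proof (induction N arbitrary: a)
  case 0
  have "1 + \<rho> \<le> (1 + \<rho>) / (1 - \<rho>)" using \<rho> by (simp add: field_simps)
  then have "(1 + \<rho>) * (cmod (a []))\<^sup>2 \<le> (1 + \<rho>) / (1 - \<rho>) * (cmod (a []))\<^sup>2"
    by (rule mult_right_mono) simp
  then show ?case
    by (simp add: psum_def hom_0 wt_0 norm_scaleC u cinner_scaleC_left cinner_self algebra_simps)
next
  case (Suc N)
  \<comment> \<open>The polynomial is split into its constant term \<open>a []\<close>, the tails
    \<open>v i\<close> after a first letter \<open>i\<close>, and their recombination
    \<open>w\<close>.\<close>
  define v where "v i = psum (\<lambda>\<alpha>. a (i # \<alpha>)) N X u" for i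
  define w where "w = (\<Sum>i\<in>UNIV. X i (v i))"
  define x where "x = sqrt (\<Sum>i\<in>UNIV. (cmod (cinner (v i) u))\<^sup>2)"
  define y where "y = cmod (a [])"
  define W where "W = (\<Sum>i\<in>UNIV. \<Sum>k\<le>N. wt (\<lambda>\<alpha>. a (i # \<alpha>)) k)"
  define C where "C = (1 + \<rho>) / (1 - \<rho>)"
  have x: "x\<^sup>2 = (\<Sum>i\<in>UNIV. (cmod (cinner (v i) u))\<^sup>2)" "x \<ge> 0"
    by (simp_all add: x_def sum_nonneg)
  have psum: "psum a (Suc N) X u = a [] *\<^sub>C u + w"
    by (simp add: psum_Suc[OF BH] w_def v_def blinfun.add_left blinfun.sum_left)
  have wu: "cinner w u = (\<Sum>i\<in>UNIV. l i * cinner (v i) u)"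
    by (simp add: w_def cinner_sum_left eig)
  have wu_le: "cmod (cinner w u) \<le> \<rho> * x"
  proof -
    have "cmod (cinner w u) \<le> (\<Sum>i\<in>UNIV. cmod (l i) * cmod (cinner (v i) u))"
      unfolding wu by (rule sum_norm_le) (simp add: norm_mult)
    also have "\<dots> \<le> sqrt (\<Sum>i\<in>UNIV. (cmod (l i))\<^sup>2) * x"
      unfolding x_def by (rule sum_mult_le_sqrt)
    finally show ?thesis using \<rho> by simp
  qed
  \<comment> \<open>The extra term of the induction hypothesis is kept: its contribution
    \<open>- \<rho> * x\<^sup>2\<close> later pays for the cross terms.\<close>
  have "(norm w)\<^sup>2 \<le> (\<Sum>i\<in>UNIV. (norm (v i))\<^sup>2)"
    using row_boundD[OF row] by (simp add: w_def)
  also have "\<dots> \<le> (\<Sum>i\<in>UNIV. C * (\<Sum>k\<le>N. wt (\<lambda>\<alpha>. a (i # \<alpha>)) k) - \<rho> * (cmod (cinner (v i) u))\<^sup>2)"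
    using Suc.IH by (intro sum_mono) (simp add: v_def C_def algebra_simps)
  also have "\<dots> = C * W - \<rho> * x\<^sup>2"
    by (simp add: sum_subtractf x W_def sum_distrib_left)
  finally have w_le: "(norm w)\<^sup>2 \<le> C * W - \<rho> * x\<^sup>2" .
  have "(norm (a [] *\<^sub>C u + w))\<^sup>2 = y\<^sup>2 + 2 * inner (a [] *\<^sub>C u) w + (norm w)\<^sup>2"
    by (simp add: power2_norm_eq_inner inner_simps inner_commute y_def norm_scaleC u
        flip: power2_norm_eq_inner[of "a [] *\<^sub>C u"])
  also have "inner (a [] *\<^sub>C u) w \<le> y * (\<rho> * x)"
  proof -
    have "inner (a [] *\<^sub>C u) w \<le> cmod (a [] * cinner u w)"
      unfolding inner_cinner cinner_scaleC_left by (rule complex_Re_le_cmod)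
    also have "\<dots> = y * cmod (cinner w u)"
      by (subst cinner_commute) (simp add: norm_mult y_def)
    also have "\<dots> \<le> y * (\<rho> * x)" using wu_le by (intro mult_left_mono) (auto simp: y_def)
    finally show ?thesis .
  qed
  finally have n1: "(norm (a [] *\<^sub>C u + w))\<^sup>2 \<le> y\<^sup>2 + 2 * (y * (\<rho> * x)) + (C * W - \<rho> * x\<^sup>2)"
    using w_le by simp
  have "cinner (a [] *\<^sub>C u + w) u = a [] + cinner w u"
    by (simp add: cinner_add_left cinner_scaleC_left cinner_self u)
  then have "cmod (cinner (a [] *\<^sub>C u + w) u) \<le> y + \<rho> * x"
    using norm_triangle_ineq[of "a []" "cinner w u"] wu_le by (simp add: y_def)
  then have n2: "\<rho> * (cmod (cinner (a [] *\<^sub>C u + w) u))\<^sup>2 \<le> \<rho> * (y + \<rho> * x)\<^sup>2"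
    using \<rho> by (intro mult_left_mono power_mono) auto
  have "C * y\<^sup>2 - (y\<^sup>2 + 2 * (y * (\<rho> * x)) - \<rho> * x\<^sup>2 + \<rho> * (y + \<rho> * x)\<^sup>2)
      = (1 + \<rho>) * \<rho> / (1 - \<rho>) * (y - (1 - \<rho>) * x)\<^sup>2"
    unfolding C_def using \<rho> by (simp add: divide_simps) (simp add: algebra_simps power2_eq_square)
  moreover have "(1 + \<rho>) * \<rho> / (1 - \<rho>) * (y - (1 - \<rho>) * x)\<^sup>2 \<ge> 0" using \<rho> by simp
  ultimately have "(norm (a [] *\<^sub>C u + w))\<^sup>2 + \<rho> * (cmod (cinner (a [] *\<^sub>C u + w) u))\<^sup>2 \<le> C * y\<^sup>2 + C * W"
    using n1 n2 by linarith
  also have "\<dots> = C * (\<Sum>k\<le>Suc N. wt a k)"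
    unfolding sum.atMost_Suc_shift by (simp add: wt_0 wt_Suc W_def y_def sum.swap[of _ UNIV] distrib_left)
  finally show ?case by (simp add: psum C_def)
qed

lemma words_upto: "{\<alpha>. length \<alpha> \<le> N} = (\<Union>k\<le>N. {\<alpha>. length \<alpha> = k})"
  by auto

lemma finite_words_upto [simp]: "finite {\<alpha> :: 'n::finite list. length \<alpha> \<le> N}"
  unfolding words_upto by auto

lemma sum_wt: "(\<Sum>k\<le>N. wt a k) = (\<Sum>\<alpha> | length \<alpha> \<le> N. (cmod (a \<alpha>))\<^sup>2)"
  unfolding wt_def words_upto by (rule sum.UNION_disjoint[symmetric]) auto

lemma sum_wt_le_infsum:
  assumes "(\<lambda>\<alpha>. (cmod (a \<alpha>))\<^sup>2) summable_on UNIV"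
  shows "(\<Sum>k\<le>N. wt a k) \<le> (\<Sum>\<^sub>\<infinity>\<alpha>. (cmod (a \<alpha>))\<^sup>2)"
  unfolding sum_wt by (rule finite_sum_le_infsum[OF assms]) auto

lemma wt_le_infsum:
  assumes "(\<lambda>\<alpha>. (cmod (a \<alpha>))\<^sup>2) summable_on UNIV"
  shows "wt a k \<le> (\<Sum>\<^sub>\<infinity>\<alpha>. (cmod (a \<alpha>))\<^sup>2)"
  unfolding wt_def by (rule finite_sum_le_infsum[OF assms]) auto

lemma infsum_le_of_bounded:
  fixes c :: "'n::finite list \<Rightarrow> complex"
  assumes "\<And>F. finite F \<Longrightarrow> (\<Sum>\<alpha>\<in>F. (cmod (c \<alpha>))\<^sup>2) \<le> K"
  shows "(\<lambda>\<alpha>. (cmod (c \<alpha>))\<^sup>2) summable_on UNIV" "(\<Sum>\<^sub>\<infinity>\<alpha>. (cmod (c \<alpha>))\<^sup>2) \<le> K"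
proof -
  show *: "(\<lambda>\<alpha>. (cmod (c \<alpha>))\<^sup>2) summable_on UNIV"
    by (rule nonneg_bdd_above_summable_on) (use assms in \<open>auto intro!: bdd_aboveI\<close>)
  show "(\<Sum>\<^sub>\<infinity>\<alpha>. (cmod (c \<alpha>))\<^sup>2) \<le> K"
    by (rule infsum_le_finite_sums[OF *]) (use assms in auto)
qed

section \<open>Norm bound for composition\<close>

context free_shift
begin

lemma cinner_hom_rS_vacuum:
  "cinner (blinfun_apply (hom_part a k (rS r)) h) (e []) = (if k = 0 then a [] * cinner h (e []) else 0)"
proof (cases k)
  case (Suc l)
  show ?thesis
    by (simp add: Suc hom_Suc[OF rS_BH] blinfun.sum_left cinner_sum_left rS_def blinfun.scaleR_left
        scaleR_scaleC cinner_scaleC_left vacuum)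
qed (simp add: hom_0 cinner_scaleC_left)

text \<open>Positive degrees have range orthogonal to the vacuum, so only the constant term
  survives. Hence the vacuum is an eigenvector of the adjoint of \<open>T\<close>, the hypothesis
  \<open>eig\<close> of \<open>norm_psum_vacuum\<close>.\<close>

lemma cinner_series_rS_vacuum:
  assumes "(\<lambda>k. hom_part a k (rS r)) sums T"
  shows "cinner (blinfun_apply T h) (e []) = a [] * cinner h (e [])"
proof -
  have "bounded_linear (\<lambda>T. cinner (blinfun_apply T h) (e []))"
    by (rule bounded_linear_compose[OF bounded_linear_cinner_left blinfun.bounded_linear_left])
  from bounded_linear.sums[OF this assms] show ?thesis
    using sums_unique2 sums_single[of 0 "\<lambda>_. a [] * cinner h (e [])"]
    by (simp add: cinner_hom_rS_vacuum) blast
qed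

text \<open>\<open>norm_psum_vacuum\<close> at the row contraction \<open>\<phi> (rS r)\<close>
  bounds partial sums uniformly in \<open>N\<close> and \<open>r\<close>. Letting \<open>N\<close>
  grow bounds \<open>f (\<phi> (rS r))\<close> on the vacuum; Bessel and the limit of
  \<open>r\<close> to 1 bound the coefficients of the composition.\<close>

lemma littlewood_subordination:
  fixes \<phi> :: "('n \<Rightarrow> ('h \<Rightarrow>\<^sub>L 'h)) \<Rightarrow> ('n \<Rightarrow> ('h \<Rightarrow>\<^sub>L 'h))"
  assumes \<phi>: "free_self_map \<phi>" and p: "\<And>i. free_expansion (\<lambda>X. \<phi> X i) (p i)"
    and \<rho>: "(\<Sum>i\<in>UNIV. (cmod (p i []))\<^sup>2) = \<rho>\<^sup>2" "0 \<le> \<rho>" "\<rho> < 1"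
    and f: "has_free_series f a" and sa: "(\<lambda>\<alpha>. (cmod (a \<alpha>))\<^sup>2) summable_on UNIV"
  obtains c where "has_free_series (comp_op \<phi> f) c" "(\<lambda>\<alpha>. (cmod (c \<alpha>))\<^sup>2) summable_on UNIV"
    "(\<Sum>\<^sub>\<infinity>\<alpha>. (cmod (c \<alpha>))\<^sup>2) \<le> (1 + \<rho>) / (1 - \<rho>) * (\<Sum>\<^sub>\<infinity>\<alpha>. (cmod (a \<alpha>))\<^sup>2)"
proof -
  define K where "K = (1 + \<rho>) / (1 - \<rho>) * (\<Sum>\<^sub>\<infinity>\<alpha>. (cmod (a \<alpha>))\<^sup>2)"
  obtain c where c: "\<And>X. X \<in> op_ball \<Longrightarrow> (\<lambda>m. hom_part c m X) sums f (\<phi> X)"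
    using comp_expansion[OF \<phi> has_free_series_expansion[OF f]] by blast
  have norm_le: "(norm (f (\<phi> (rS r)) (e [])))\<^sup>2 \<le> K" if r: "0 \<le> r" "r < 1" for r
  proof -
    have X: "rS r \<in> op_ball" using r by (rule rS_op_ball)
    from free_self_map_op_ball[OF \<phi> X] obtain t where
      t: "0 \<le> t" "t < 1" "row_bound (\<phi> (rS r)) t" and BH: "\<And>i. \<phi> (rS r) i \<in> BH"
      by (auto simp: op_ball_iff)
    have row1: "row_bound (\<phi> (rS r)) 1"
      unfolding row_bound_def
    proof
      fix h
      have "t\<^sup>2 * (\<Sum>i\<in>UNIV. (norm (h i :: 'h))\<^sup>2) \<le> 1 * (\<Sum>i\<in>(UNIV :: 'n set). (norm (h i))\<^sup>2)"
        using t by (intro mult_right_mono sum_nonneg) (auto simp: power_le_one)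
      with row_boundD[OF t(3), of h]
      show "(norm (\<Sum>i\<in>UNIV. \<phi> (rS r) i (h i)))\<^sup>2 \<le> 1\<^sup>2 * (\<Sum>i\<in>UNIV. (norm (h i))\<^sup>2)" by simp
    qed
    have eig: "cinner (\<phi> (rS r) i h) (e []) = p i [] * cinner h (e [])" for i h
      by (rule cinner_series_rS_vacuum[where r = r]) (use p[of i] X in \<open>simp add: free_expansion_def\<close>)
    have le: "(norm (psum a N (\<phi> (rS r)) (e [])))\<^sup>2 \<le> K" for N
    proof -
      have "(norm (psum a N (\<phi> (rS r)) (e [])))\<^sup>2 \<le> (1 + \<rho>) / (1 - \<rho>) * (\<Sum>k\<le>N. wt a k)"
        \<comment> \<open>The term with factor \<open>\<rho>\<close> served only the induction and
          is dropped by nonnegativity.\<close>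
        using norm_psum_vacuum[OF BH row1 norm_e eig \<rho>, of a N] \<rho>(2)
        by (smt (verit) mult_nonneg_nonneg zero_le_power2)
      also have "\<dots> \<le> K"
        unfolding K_def using \<rho> by (intro mult_left_mono sum_wt_le_infsum[OF sa]) auto
      finally show ?thesis .
    qed
    have "(\<lambda>k. hom_part a k (\<phi> (rS r))) sums f (\<phi> (rS r))"
      using f free_self_map_op_ball[OF \<phi> X] by (simp add: has_free_series_iff)
    then have "(\<lambda>N. psum a N (\<phi> (rS r))) \<longlonglongrightarrow> f (\<phi> (rS r))"
      unfolding psum_def sums_def_le .
    from bounded_linear.tendsto[OF blinfun.bounded_linear_left this]
    have "(\<lambda>N. psum a N (\<phi> (rS r)) (e [])) \<longlonglongrightarrow> f (\<phi> (rS r)) (e [])" .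
    then have "(\<lambda>N. (norm (psum a N (\<phi> (rS r)) (e [])))\<^sup>2) \<longlonglongrightarrow> (norm (f (\<phi> (rS r)) (e [])))\<^sup>2"
      by (intro tendsto_power tendsto_norm)
    then show ?thesis using le by (intro LIMSEQ_le_const2) auto
  qed
  have fin: "(\<Sum>\<gamma>\<in>F. (cmod (c \<gamma>))\<^sup>2) \<le> K" if F: "finite F" for F
  proof (rule tendsto_upperbound)
    have "((\<lambda>r. \<Sum>\<gamma>\<in>F. r ^ (2 * length \<gamma>) * (cmod (c \<gamma>))\<^sup>2) \<longlongrightarrow> (\<Sum>\<gamma>\<in>F. 1 ^ (2 * length \<gamma>) * (cmod (c \<gamma>))\<^sup>2)) (at_left (1::real))"
      by (intro tendsto_intros)
    then show "((\<lambda>r. \<Sum>\<gamma>\<in>F. r ^ (2 * length \<gamma>) * (cmod (c \<gamma>))\<^sup>2) \<longlongrightarrow> (\<Sum>\<gamma>\<in>F. (cmod (c \<gamma>))\<^sup>2)) (at_left (1::real))"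
      by simp
    show "\<forall>\<^sub>F r in at_left 1. (\<Sum>\<gamma>\<in>F. r ^ (2 * length \<gamma>) * (cmod (c \<gamma>))\<^sup>2) \<le> K"
      using eventually_at_left_real[of 0 1]
    proof (rule eventually_mono)
      fix r :: real assume "r \<in> {0<..<1}"
      then have r: "0 \<le> r" "r < 1" by auto
      show "(\<Sum>\<gamma>\<in>F. r ^ (2 * length \<gamma>) * (cmod (c \<gamma>))\<^sup>2) \<le> K"
        using Bessel_series_rS[OF c[OF rS_op_ball[OF r]] F] norm_le[OF r] by linarith
    qed simp
  qed simp
  note c2 = infsum_le_of_bounded[of c, OF fin]
  have "has_free_series (comp_op \<phi> f) c"
    unfolding has_free_series_iff
  proof
    \<comment> \<open>Square summability bounds the weights, which restores the root
      condition.\<close>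
    show "limsup (\<lambda>k. ereal (root (2 * k) (wt c k))) \<le> 1"
      by (rule limsup_bounded_wt[OF wt_le_infsum[OF c2(1)]])
  qed (use c in \<open>auto simp: comp_op_def\<close>)
  then show ?thesis using c2 unfolding K_def by (rule that)
qed

end

subsection \<open>Point evaluations\<close>

definition monomial :: "complex ^ 'n::finite \<Rightarrow> 'n list \<Rightarrow> complex" where
  "monomial z \<alpha> = (\<Prod>i\<leftarrow>\<alpha>. z $ i)"

lemma monomial_Nil [simp]: "monomial z [] = 1"
  and monomial_Cons [simp]: "monomial z (i # \<alpha>) = z $ i * monomial z \<alpha>"
  by (simp_all add: monomial_def)

lemma scalar_tuple_BH: "scalar_tuple z i \<in> BH"
  by (simp add: BH_def scalar_tuple_def scaleC_scaleC mult.commute)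

lemma word_op_scalar: "word_op (scalar_tuple z) \<alpha> = monomial z \<alpha> *\<^sub>O id_blinfun"
  by (induction \<alpha>)
    (auto intro!: blinfun_eqI simp: scaleC_one scalar_tuple_def scaleC_scaleC)

lemma hom_scalar:
  "hom_part a k (scalar_tuple z) = (\<Sum>\<alpha> | length \<alpha> = k. a \<alpha> * monomial z \<alpha>) *\<^sub>O id_blinfun"
  by (rule blinfun_eqI)
    (simp add: hom_part_def word_op_scalar blinfun.sum_left scaleC_scaleC complex_vector.scale_sum_left)

lemma norm_vec_power2: "(norm z)\<^sup>2 = (\<Sum>i\<in>UNIV. (cmod (z $ i))\<^sup>2)"
  by (simp add: norm_vec_def L2_set_def sum_nonneg)

lemma scalar_tuple_row: "row_bound (scalar_tuple z) (norm z)"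
  unfolding row_bound_def
proof
  fix h
  have "norm (\<Sum>i\<in>UNIV. scalar_tuple z i (h i)) \<le> (\<Sum>i\<in>UNIV. cmod (z $ i) * norm (h i))"
    by (rule sum_norm_le) (simp add: scalar_tuple_def norm_scaleC)
  also have "\<dots> \<le> norm z * sqrt (\<Sum>i\<in>UNIV. (norm (h i))\<^sup>2)"
    unfolding norm_vec_def L2_set_def by (rule sum_mult_le_sqrt)
  finally have "(norm (\<Sum>i\<in>UNIV. scalar_tuple z i (h i)))\<^sup>2 \<le> (norm z * sqrt (\<Sum>i\<in>UNIV. (norm (h i))\<^sup>2))\<^sup>2"
    by (rule power_mono) simp
  then show "(norm (\<Sum>i\<in>UNIV. scalar_tuple z i (h i)))\<^sup>2 \<le> (norm z)\<^sup>2 * (\<Sum>i\<in>UNIV. (norm (h i))\<^sup>2)"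
    by (simp add: power_mult_distrib sum_nonneg)
qed

lemma scalar_tuple_op_ball: "norm z < 1 \<Longrightarrow> scalar_tuple z \<in> op_ball"
  unfolding op_ball_iff using scalar_tuple_BH scalar_tuple_row norm_ge_zero by blast

lemma wt_monomial: "wt (monomial z) k = ((norm z)\<^sup>2) ^ k"
proof -
  \<comment> \<open>The scalar \<open>c\<close> is carried along because removing the first letter
    leaves a factor \<open>z $ i\<close>.\<close>
  have "wt (\<lambda>\<alpha>. c * monomial z \<alpha>) k = (cmod c)\<^sup>2 * ((norm z)\<^sup>2) ^ k" for c
  proof (induction k arbitrary: c)
    case (Suc k)
    have "wt (\<lambda>\<alpha>. c * monomial z \<alpha>) (Suc k) = (\<Sum>i\<in>UNIV. wt (\<lambda>\<alpha>. (c * z $ i) * monomial z \<alpha>) k)"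
      by (simp add: wt_Suc mult_ac)
    also have "\<dots> = (cmod c)\<^sup>2 * ((norm z)\<^sup>2) ^ Suc k"
      unfolding Suc.IH
      by (simp add: norm_vec_power2 norm_mult power_mult_distrib sum_distrib_left sum_distrib_right mult_ac)
    finally show ?case .
  qed (simp add: wt_0)
  from this[of 1] show ?thesis by simp
qed

text \<open>Cauchy-Schwarz between the weights and the powers of \<open>t\<close>. At a scalar tuple
  with \<open>t = norm z\<close> it is the reproducing kernel estimate.\<close>

lemma norm_le_H2:
  assumes f: "has_free_series f a" and sa: "(\<lambda>\<alpha>. (cmod (a \<alpha>))\<^sup>2) summable_on UNIV"
    and X: "\<And>i. X i \<in> BH" "row_bound X t" "0 \<le> t" "t < 1"
  shows "norm (f X) \<le> sqrt (\<Sum>\<^sub>\<infinity>\<alpha>. (cmod (a \<alpha>))\<^sup>2) / sqrt (1 - t\<^sup>2)"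
proof -
  have t2: "t\<^sup>2 < 1" using X by (simp add: power_less_one_iff)
  have X': "X \<in> op_ball" using X by (auto simp: op_ball_iff)
  have "norm (\<Sum>k\<le>N. hom_part a k X) \<le> sqrt (\<Sum>\<^sub>\<infinity>\<alpha>. (cmod (a \<alpha>))\<^sup>2) * sqrt (1 / (1 - t\<^sup>2))" for N
  proof -
    have "norm (\<Sum>k\<le>N. hom_part a k X) \<le> (\<Sum>k\<le>N. sqrt (wt a k) * t ^ k)"
      by (rule sum_norm_le) (rule norm_hom[OF X(1,2,3)])
    also have "\<dots> \<le> sqrt (\<Sum>k\<le>N. (sqrt (wt a k))\<^sup>2) * sqrt (\<Sum>k\<le>N. (t ^ k)\<^sup>2)"
      by (rule sum_mult_le_sqrt)
    also have "(\<Sum>k\<le>N. (sqrt (wt a k))\<^sup>2) = (\<Sum>k\<le>N. wt a k)" by simp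
    also have "(\<Sum>k\<le>N. (t ^ k)\<^sup>2) = (\<Sum>k\<le>N. (t\<^sup>2) ^ k)" by (simp add: mult.commute flip: power_mult)
    also have "sqrt (\<Sum>k\<le>N. wt a k) * sqrt (\<Sum>k\<le>N. (t\<^sup>2) ^ k)
        \<le> sqrt (\<Sum>\<^sub>\<infinity>\<alpha>. (cmod (a \<alpha>))\<^sup>2) * sqrt (1 / (1 - t\<^sup>2))"
    proof (intro mult_mono real_sqrt_le_mono sum_wt_le_infsum[OF sa])
      have "(\<Sum>k\<le>N. (t\<^sup>2) ^ k) \<le> (\<Sum>k. (t\<^sup>2) ^ k)"
        by (rule sum_le_suminf) (use t2 in auto)
      also have "\<dots> = 1 / (1 - t\<^sup>2)" by (rule suminf_geometric) (use t2 in simp)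
      finally show "(\<Sum>k\<le>N. (t\<^sup>2) ^ k) \<le> 1 / (1 - t\<^sup>2)" .
    qed (auto simp: sum_nonneg infsum_nonneg)
    finally show ?thesis .
  qed
  moreover have "(\<lambda>N. norm (\<Sum>k\<le>N. hom_part a k X)) \<longlonglongrightarrow> norm (f X)"
    using f X' by (intro tendsto_norm) (simp add: has_free_series_iff sums_def_le)
  ultimately have "norm (f X) \<le> sqrt (\<Sum>\<^sub>\<infinity>\<alpha>. (cmod (a \<alpha>))\<^sup>2) * sqrt (1 / (1 - t\<^sup>2))"
    by (intro LIMSEQ_le_const2) auto
  then show ?thesis by (simp add: real_sqrt_divide)
qed

section \<open>The induced map of the Euclidean ball and kernel functions\<close>

context free_shift
begin

lemma H2_ball_iff:
  fixes f :: "('n \<Rightarrow> ('h \<Rightarrow>\<^sub>L 'h)) \<Rightarrow> ('h \<Rightarrow>\<^sub>L 'h)"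
  shows "f \<in> H2_ball \<longleftrightarrow> (\<exists>a. has_free_series f a \<and> (\<lambda>\<alpha>. (cmod (a \<alpha>))\<^sup>2) summable_on UNIV) \<and>
    (\<forall>X. X \<notin> op_ball \<longrightarrow> f X = 0)"
  unfolding H2_ball_def free_holomorphic_def using free_coeff_eq by auto

lemma H2_norm_eq:
  "has_free_series f a \<Longrightarrow> H2_norm f = sqrt (\<Sum>\<^sub>\<infinity>\<alpha>. (cmod (a \<alpha>))\<^sup>2)"
  for f :: "('n \<Rightarrow> ('h \<Rightarrow>\<^sub>L 'h)) \<Rightarrow> ('h \<Rightarrow>\<^sub>L 'h)"
  by (simp add: H2_norm_def free_coeff_eq)

lemma norm_scalar_op: "norm (c *\<^sub>O (id_blinfun :: 'h \<Rightarrow>\<^sub>L 'h)) \<ge> cmod c"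
  using norm_blinfun[of "c *\<^sub>O (id_blinfun :: 'h \<Rightarrow>\<^sub>L 'h)" "e []"] by (simp add: norm_scaleC)

lemma cinner_scalar_op: "cinner (blinfun_apply (c *\<^sub>O id_blinfun) (e [])) (e []) = c"
  using orth by (simp add: cinner_scaleC_left orthonormal_def)

lemma scalar_tuple_inj: "scalar_tuple z = (scalar_tuple w :: 'n \<Rightarrow> ('h \<Rightarrow>\<^sub>L 'h)) \<Longrightarrow> z = w"
  by (rule vec_eq_iff[THEN iffD2]) (metis cinner_scalar_op scalar_tuple_def)

lemma norm_of_scalar_tuple:
  assumes "(scalar_tuple z :: 'n \<Rightarrow> ('h \<Rightarrow>\<^sub>L 'h)) \<in> op_ball"
  shows "norm z < 1"
proof (cases "z = 0")
  case False
  obtain t where t: "0 \<le> t" "t < 1" "row_bound (scalar_tuple z :: 'n \<Rightarrow> ('h \<Rightarrow>\<^sub>L 'h)) t"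
    using assms by (auto simp: op_ball_iff)
  \<comment> \<open>The equality case of Cauchy-Schwarz: on this tuple the row of scalars attains
    its norm.\<close>
  have "(\<Sum>i\<in>UNIV. scalar_tuple z i (cnj (z $ i) *\<^sub>C e [])) = complex_of_real ((norm z)\<^sup>2) *\<^sub>C e []"
    by (simp add: scalar_tuple_def scaleC_scaleC norm_vec_power2 complex_norm_square
        complex_vector.scale_sum_left of_real_sum del: of_real_power)
  then have "((norm z)\<^sup>2)\<^sup>2 \<le> t\<^sup>2 * (norm z)\<^sup>2"
    using row_boundD[OF t(3), of "\<lambda>i. cnj (z $ i) *\<^sub>C e []"]
    by (simp add: norm_scaleC norm_vec_power2[of z, symmetric] del: of_real_power)
  then have "(norm z)\<^sup>2 \<le> t\<^sup>2" using False by (simp add: power2_eq_square)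
  with t show ?thesis using power2_le_imp_le[of "norm z" t] by linarith
qed simp

text \<open>Partial sums at a scalar tuple are scalar operators. Pairing with the vacuum shows that
  their scalars converge, so the limit is scalar too; \<open>scalar_tuple_inj\<close> then settles
  the \<open>THE\<close>.\<close>

lemma induced_map:
  fixes \<phi> :: "('n \<Rightarrow> ('h \<Rightarrow>\<^sub>L 'h)) \<Rightarrow> ('n \<Rightarrow> ('h \<Rightarrow>\<^sub>L 'h))"
  assumes \<phi>: "free_self_map \<phi>" and z: "norm z < 1"
  shows "\<phi> (scalar_tuple z) = scalar_tuple (induced_map \<phi> z)" "norm (induced_map \<phi> z) < 1"
proof -
  have X: "(scalar_tuple z :: 'n \<Rightarrow> ('h \<Rightarrow>\<^sub>L 'h)) \<in> op_ball" by (rule scalar_tuple_op_ball[OF z])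
  have "\<exists>c. \<phi> (scalar_tuple z) i = c *\<^sub>O id_blinfun" for i
  proof -
    obtain p where "has_free_series (\<lambda>X. \<phi> X i) p"
      using \<phi> by (auto simp: free_self_map_def free_holomorphic_def)
    then have "(\<lambda>k. hom_part p k (scalar_tuple z)) sums \<phi> (scalar_tuple z) i"
      using X by (simp add: has_free_series_iff)
    moreover define g where "g k = (\<Sum>\<alpha> | length \<alpha> = k. p \<alpha> * monomial z \<alpha>)" for k
    ultimately have g: "(\<lambda>k. g k *\<^sub>O id_blinfun) sums \<phi> (scalar_tuple z) i"
      by (simp add: hom_scalar)
    have "bounded_linear (\<lambda>T. cinner (blinfun_apply T (e [])) (e []))"
      by (rule bounded_linear_compose[OF bounded_linear_cinner_left blinfun.bounded_linear_left])
    from bounded_linear.sums[OF this g]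
    have "g sums cinner (\<phi> (scalar_tuple z) i (e [])) (e [])"
      unfolding cinner_scalar_op .
    from bounded_linear.sums[OF bounded_linear_op_scaleC this] g show ?thesis
      using sums_unique2 by blast
  qed
  then obtain c where c: "\<And>i. \<phi> (scalar_tuple z) i = c i *\<^sub>O id_blinfun" by metis
  have eq: "\<phi> (scalar_tuple z) = scalar_tuple (\<chi> i. c i)"
    by (rule ext, subst c) (simp add: scalar_tuple_def)
  have "induced_map \<phi> z = (\<chi> i. c i)"
    unfolding induced_map_def
  proof (rule the_equality)
    show "\<phi> (scalar_tuple z) = scalar_tuple (\<chi> i. c i)" by (fact eq)
  next
    fix w assume "\<phi> (scalar_tuple z) = scalar_tuple w"
    then show "w = (\<chi> i. c i)" unfolding eq by (rule scalar_tuple_inj[symmetric])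
  qed
  then show *: "\<phi> (scalar_tuple z) = scalar_tuple (induced_map \<phi> z)"
    by (simp only: eq)
  show "norm (induced_map \<phi> z) < 1"
    using free_self_map_op_ball[OF \<phi> X] unfolding *
    by (rule norm_of_scalar_tuple)
qed

lemma normalized_kernel:
  assumes w: "norm w < 1"
  obtains f :: "('n \<Rightarrow> ('h \<Rightarrow>\<^sub>L 'h)) \<Rightarrow> ('h \<Rightarrow>\<^sub>L 'h)"
  where "f \<in> H2_ball" "H2_norm f \<le> 1"
    "f (scalar_tuple w) = complex_of_real (1 / sqrt (1 - (norm w)\<^sup>2)) *\<^sub>O id_blinfun"
proof -
  have X: "(scalar_tuple w :: 'n \<Rightarrow> ('h \<Rightarrow>\<^sub>L 'h)) \<in> op_ball" by (rule scalar_tuple_op_ball[OF w])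
  define s where "s = sqrt (1 - (norm w)\<^sup>2)"
  define q where "q = (norm w)\<^sup>2"
  have q: "0 \<le> q" "q < 1" using w by (auto simp: q_def power_less_one_iff)
  have s: "s > 0" "s\<^sup>2 = 1 - q" using q by (simp_all add: s_def q_def)
  \<comment> \<open>The reproducing kernel at \<open>w\<close> has squared norm
    \<open>1 / (1 - q)\<close>; the factor \<open>s\<close> normalizes it.\<close>
  define a where "a \<alpha> = complex_of_real s * cnj (monomial w \<alpha>)" for \<alpha>
  have wt: "wt a k = s\<^sup>2 * q ^ k" for k
    using wt_monomial[of w k]
    by (simp add: a_def wt_def q_def norm_mult power_mult_distrib flip: sum_distrib_left)
  have geo: "(\<lambda>k. s\<^sup>2 * q ^ k) sums 1"
    using sums_mult[OF geometric_sums[of q], of "s\<^sup>2"] q s by simp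
  have fin: "(\<Sum>\<alpha>\<in>F. (cmod (a \<alpha>))\<^sup>2) \<le> 1" if F: "finite F" for F
  proof -
    obtain N where N: "\<And>\<alpha>. \<alpha> \<in> F \<Longrightarrow> length \<alpha> \<le> N"
      using finite_nat_set_iff_bounded_le[of "length ` F"] F by auto
    have "(\<Sum>\<alpha>\<in>F. (cmod (a \<alpha>))\<^sup>2) \<le> (\<Sum>k\<le>N. wt a k)"
      unfolding sum_wt by (rule sum_mono2) (use N in auto)
    also have "\<dots> \<le> (\<Sum>k. s\<^sup>2 * q ^ k)"
      unfolding wt by (rule sum_le_suminf[OF sums_summable[OF geo]]) (use q in auto)
    also have "\<dots> = 1" using sums_unique[OF geo] by simp
    finally show ?thesis .
  qed
  note a2 = infsum_le_of_bounded[of a, OF fin]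
  have lim: "limsup (\<lambda>k. ereal (root (2 * k) (wt a k))) \<le> 1"
    by (rule limsup_bounded_wt[OF wt_le_infsum[OF a2(1)]])
  define f where "f X = (if X \<in> op_ball then \<Sum>k. hom_part a k X else 0)" for X :: "'n \<Rightarrow> ('h \<Rightarrow>\<^sub>L 'h)"
  have f: "has_free_series f a"
    unfolding has_free_series_iff
    using lim by (auto simp: f_def intro!: summable_sums summable_norm_cancel[OF summable_norm_hom]
        free_coeffs_limsup)
  have "f \<in> H2_ball" unfolding H2_ball_iff using f a2(1) by (auto simp: f_def)
  moreover have "H2_norm f \<le> 1" using a2(2) by (simp add: H2_norm_eq[OF f])
  moreover have "f (scalar_tuple w) = complex_of_real (1 / s) *\<^sub>O id_blinfun"
  proof -
    have "(\<Sum>\<alpha> | length \<alpha> = k. a \<alpha> * monomial w \<alpha>) = complex_of_real (s * q ^ k)" for k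
    proof -
      have "(\<Sum>\<alpha> | length \<alpha> = k. a \<alpha> * monomial w \<alpha>) = complex_of_real s * complex_of_real (wt (monomial w) k)"
        by (simp add: a_def wt_def complex_norm_square sum_distrib_left mult_ac del: of_real_power)
      then show ?thesis by (simp add: wt_monomial q_def)
    qed
    then have hom_part: "hom_part a k (scalar_tuple w) = complex_of_real (s * q ^ k) *\<^sub>O id_blinfun" for k
      by (simp only: hom_scalar)
    have "(\<lambda>k. s * q ^ k) sums (s * (1 / (1 - q)))"
      using sums_mult[OF geometric_sums[of q], of s] q by simp
    also have "s * (1 / (1 - q)) = 1 / s"
      unfolding s(2)[symmetric] using s(1) by (simp add: power2_eq_square)
    finally have "(\<lambda>k. complex_of_real (s * q ^ k) *\<^sub>O (id_blinfun :: 'h \<Rightarrow>\<^sub>L 'h)) sums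
        (complex_of_real (1 / s) *\<^sub>O id_blinfun)"
      by (intro bounded_linear.sums[OF bounded_linear_op_scaleC] sums_of_real)
    moreover have "(\<lambda>k. hom_part a k (scalar_tuple w)) sums f (scalar_tuple w)"
      using f X by (simp add: has_free_series_iff)
    ultimately show ?thesis unfolding hom_part using sums_unique2 by blast
  qed
  ultimately show ?thesis using that unfolding s_def by blast
qed

lemma comp_op_H2:
  fixes \<phi> :: "('n \<Rightarrow> ('h \<Rightarrow>\<^sub>L 'h)) \<Rightarrow> ('n \<Rightarrow> ('h \<Rightarrow>\<^sub>L 'h))"
  assumes \<phi>: "free_self_map \<phi>" and f: "f \<in> H2_ball"
  shows "comp_op \<phi> f \<in> H2_ball"
    "H2_norm (comp_op \<phi> f)
      \<le> sqrt ((1 + norm (induced_map \<phi> 0)) / (1 - norm (induced_map \<phi> 0))) * H2_norm f"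
proof -
  define l where "l = induced_map \<phi> 0"
  have l: "\<phi> (scalar_tuple 0) = scalar_tuple l" "norm l < 1"
    unfolding l_def by (rule induced_map[OF \<phi>]; simp)+
  have "\<forall>i. \<exists>p. free_expansion (\<lambda>X. \<phi> X i) p"
    using \<phi> has_free_series_expansion unfolding free_self_map_def free_holomorphic_def by blast
  from choice[OF this] obtain p where p: "\<And>i. free_expansion (\<lambda>X. \<phi> X i) (p i)" by blast
  \<comment> \<open>At the zero tuple the constant terms of the \<open>\<phi> X i\<close> become the
    coordinates of the image of 0, which identifies \<open>\<rho>\<close> with
    \<open>norm l\<close>.\<close>
  have zero: "rS 0 = scalar_tuple 0"
    by (rule ext) (auto intro!: blinfun_eqI simp: rS_def scalar_tuple_def)
  have "p i [] = l $ i" for i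
  proof -
    have "cinner (\<phi> (rS 0) i (e [])) (e []) = p i [] * cinner (e []) (e [])"
      by (rule cinner_series_rS_vacuum[where r = 0])
        (use p[of i] rS_op_ball[of 0] in \<open>simp add: free_expansion_def\<close>)
    moreover have "\<phi> (rS 0) i = l $ i *\<^sub>O id_blinfun"
      unfolding zero l(1) by (simp add: scalar_tuple_def)
    ultimately show ?thesis
      using orth by (simp add: cinner_scaleC_left orthonormal_def)
  qed
  then have \<rho>: "(\<Sum>i\<in>UNIV. (cmod (p i []))\<^sup>2) = (norm l)\<^sup>2" by (simp add: norm_vec_power2)
  obtain a where a: "has_free_series f a" "(\<lambda>\<alpha>. (cmod (a \<alpha>))\<^sup>2) summable_on UNIV"
    using f by (auto simp: H2_ball_iff)
  obtain c where c: "has_free_series (comp_op \<phi> f) c" "(\<lambda>\<alpha>. (cmod (c \<alpha>))\<^sup>2) summable_on UNIV"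
    "(\<Sum>\<^sub>\<infinity>\<alpha>. (cmod (c \<alpha>))\<^sup>2) \<le> (1 + norm l) / (1 - norm l) * (\<Sum>\<^sub>\<infinity>\<alpha>. (cmod (a \<alpha>))\<^sup>2)"
    using littlewood_subordination[OF \<phi> p \<rho> norm_ge_zero l(2) a] .
  show "comp_op \<phi> f \<in> H2_ball" unfolding H2_ball_iff using c by (auto simp: comp_op_def)
  show "H2_norm (comp_op \<phi> f)
      \<le> sqrt ((1 + norm (induced_map \<phi> 0)) / (1 - norm (induced_map \<phi> 0))) * H2_norm f"
    unfolding l_def[symmetric] H2_norm_eq[OF a(1)] H2_norm_eq[OF c(1)]
    using c(3) by (simp flip: real_sqrt_mult)
qed

end

text \<open>The conjunct on \<open>bdd_above\<close> makes the real \<open>SUP\<close> over the ball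
  a genuine supremum; for \<open>H2_opnorm\<close> this follows from
  \<open>bounded_H2_operator\<close>.\<close>

theorem theorem2p3:
  fixes \<phi> :: "('n::finite \<Rightarrow> ('h::complex_hilbert \<Rightarrow>\<^sub>L 'h)) \<Rightarrow> ('n \<Rightarrow> ('h \<Rightarrow>\<^sub>L 'h))"
  assumes "separable_space (euclidean :: 'h topology)"
    and "infinite_dimensional TYPE('h)"
    and "free_self_map \<phi>"
  shows "bounded_H2_operator (comp_op \<phi>) \<and>
    1 / sqrt (1 - (norm (induced_map \<phi> 0))\<^sup>2)
      \<le> (SUP z\<in>ball 0 1. sqrt ((1 - (norm z)\<^sup>2) / (1 - (norm (induced_map \<phi> z))\<^sup>2))) \<and>
    bdd_above ((\<lambda>z. sqrt ((1 - (norm z)\<^sup>2) / (1 - (norm (induced_map \<phi> z))\<^sup>2))) ` ball 0 1) \<and>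
    (SUP z\<in>ball 0 1. sqrt ((1 - (norm z)\<^sup>2) / (1 - (norm (induced_map \<phi> z))\<^sup>2)))
      \<le> H2_opnorm (comp_op \<phi>) \<and>
    H2_opnorm (comp_op \<phi>)
      \<le> sqrt ((1 + norm (induced_map \<phi> 0)) / (1 - norm (induced_map \<phi> 0)))"
proof -
  obtain S :: "'n \<Rightarrow> ('h \<Rightarrow>\<^sub>L 'h)" and e where "free_shift S e"
    using exists_free_shift[OF assms(2)] by blast
  then interpret free_shift S e .
  note \<phi> = assms(3)
  define C where "C = sqrt ((1 + norm (induced_map \<phi> 0)) / (1 - norm (induced_map \<phi> 0)))"
  define Q where "Q z = sqrt ((1 - (norm z)\<^sup>2) / (1 - (norm (induced_map \<phi> z))\<^sup>2))" for z
  define U :: "(('n \<Rightarrow> ('h \<Rightarrow>\<^sub>L 'h)) \<Rightarrow> ('h \<Rightarrow>\<^sub>L 'h)) set" where "U = {f \<in> H2_ball. H2_norm f \<le> 1}"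
  have opnorm: "H2_opnorm (comp_op \<phi>) = (SUP f\<in>U. H2_norm (comp_op \<phi> f))"
    by (simp add: H2_opnorm_def U_def)
  have "norm (induced_map \<phi> 0) < 1" by (rule induced_map[OF \<phi>]) simp
  then have C: "C \<ge> 0" by (simp add: C_def)
  have H2: "comp_op \<phi> f \<in> H2_ball" "H2_norm (comp_op \<phi> f) \<le> C * H2_norm f" if "f \<in> H2_ball" for f
    using comp_op_H2[OF \<phi> that] by (simp_all add: C_def)
  have le_C: "H2_norm (comp_op \<phi> f) \<le> C" if "f \<in> U" for f
  proof -
    have "H2_norm (comp_op \<phi> f) \<le> C * H2_norm f" using H2 that by (simp add: U_def)
    also have "\<dots> \<le> C * 1" using C that by (intro mult_left_mono) (auto simp: U_def)
    finally show ?thesis by simp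
  qed
  have bdd: "bdd_above ((\<lambda>f. H2_norm (comp_op \<phi> f)) ` U)" using le_C by (auto intro!: bdd_aboveI)
  have bounded: "bounded_H2_operator (comp_op \<phi>)"
    unfolding bounded_H2_operator_def
  proof (intro conjI ballI allI)
    show "\<exists>K. \<forall>f\<in>H2_ball. H2_norm (comp_op \<phi> f) \<le> K * H2_norm f" using H2(2) by blast
    fix f :: "('n \<Rightarrow> ('h \<Rightarrow>\<^sub>L 'h)) \<Rightarrow> ('h \<Rightarrow>\<^sub>L 'h)" assume "f \<in> H2_ball"
    then show "comp_op \<phi> f \<in> H2_ball" by (rule H2(1))
  \<comment> \<open>Linearity is pointwise, and off the ball both sides are 0.\<close>
  qed (auto simp: comp_op_def fun_eq_iff intro!: blinfun_eqI)
  have Q_le: "Q z \<le> H2_opnorm (comp_op \<phi>)" if z: "norm z < 1" for z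
  proof -
    note w = induced_map[OF \<phi> z]
    have X: "(scalar_tuple z :: 'n \<Rightarrow> ('h \<Rightarrow>\<^sub>L 'h)) \<in> op_ball" by (rule scalar_tuple_op_ball[OF z])
    define s where "s = sqrt (1 - (norm (induced_map \<phi> z))\<^sup>2)"
    have s: "s > 0" using w(2) by (simp add: s_def power_less_one_iff)
    have z': "sqrt (1 - (norm z)\<^sup>2) > 0" using z by (simp add: power_less_one_iff)
    \<comment> \<open>The normalized kernel at the image of \<open>z\<close> takes the value
      \<open>1 / s\<close> there, and this is the value of \<open>comp_op \<phi> f\<close> at
      \<open>z\<close>; \<open>norm_le_H2\<close> at \<open>z\<close> compares it with the
      norm.\<close>
    obtain f :: "('n \<Rightarrow> ('h \<Rightarrow>\<^sub>L 'h)) \<Rightarrow> ('h \<Rightarrow>\<^sub>L 'h)" where f: "f \<in> H2_ball" "H2_norm f \<le> 1"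
      "f (scalar_tuple (induced_map \<phi> z)) = complex_of_real (1 / s) *\<^sub>O id_blinfun"
      using normalized_kernel[OF w(2)] unfolding s_def by blast
    obtain c where c: "has_free_series (comp_op \<phi> f) c" "(\<lambda>\<alpha>. (cmod (c \<alpha>))\<^sup>2) summable_on UNIV"
      using H2(1)[OF f(1)] by (auto simp: H2_ball_iff)
    have "1 / s = cmod (complex_of_real (1 / s))" unfolding norm_of_real using s by simp
    also have "\<dots> \<le> norm (comp_op \<phi> f (scalar_tuple z))"
      using norm_scalar_op[of "complex_of_real (1 / s)"] X
      by (simp add: comp_op_def w(1) f(3))
    also have "\<dots> \<le> H2_norm (comp_op \<phi> f) / sqrt (1 - (norm z)\<^sup>2)"
      unfolding H2_norm_eq[OF c(1)]
      by (rule norm_le_H2[OF c scalar_tuple_BH scalar_tuple_row norm_ge_zero z])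
    finally have "sqrt (1 - (norm z)\<^sup>2) / s \<le> H2_norm (comp_op \<phi> f)"
      using z' s by (simp add: field_simps)
    also have "\<dots> \<le> H2_opnorm (comp_op \<phi>)"
      unfolding opnorm by (rule cSUP_upper[OF _ bdd]) (simp add: U_def f)
    finally show ?thesis by (simp add: Q_def s_def real_sqrt_divide)
  qed
  have bddQ: "bdd_above (Q ` ball 0 1)" using Q_le by (auto intro!: bdd_aboveI)
  \<comment> \<open>The first inequality is the value of the quotient at the centre.\<close>
  have "Q 0 \<le> (SUP z\<in>ball 0 1. Q z)" by (rule cSUP_upper[OF _ bddQ]) simp
  then have lower: "1 / sqrt (1 - (norm (induced_map \<phi> 0))\<^sup>2) \<le> (SUP z\<in>ball 0 1. Q z)"
    by (simp add: Q_def real_sqrt_divide)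
  have mid: "(SUP z\<in>ball 0 1. Q z) \<le> H2_opnorm (comp_op \<phi>)"
    by (rule cSUP_least) (auto simp: Q_le)
  have "U \<noteq> {}"
    using normalized_kernel[of 0] by (force simp: U_def)
  then have upper: "H2_opnorm (comp_op \<phi>) \<le> C"
    unfolding opnorm by (rule cSUP_least) (rule le_C)
  show ?thesis
    using bounded lower bddQ mid upper unfolding Q_def C_def by blast
qed

end
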